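(* Let $Y$ be a geodesic $q$-manifold and let $e\colon C\to Y$ be an étale map. Then all fibers $e^{-1}(y)$, $y\in Y$, are finite.
   Context: **Convexity space.** For a Hausdorff space $U$, the power set $\mathfrak P(U)$ carries the topology with basis the sets $\widetilde W=\{A\subset U : A\subset W\}$, $W$ open in $U$. A convexity space is a Hausdorff space $U$ with a continuous map $C\colon U\times U\to\mathfrak P(U)$ such that, calling $A\subset U$ convex if $C(x,y)\subset A$ for all $x,y\in A$: (C1) every $C(x,y)$ is convex; (C2) every $C(x,y)$ is minimal among the connected sets containing $x$ and $y$; (C3) $U$ has a basis of convex open sets. A convex subset of a convexity space is a convexity space with the restricted map. **Star-finite.** A star in a convexity space $U$ with center $x$ and end set $E\subset U\setminus\{x\}$ is a subspace $S(x,E)=\bigcup_{z\in E}C(x,z)$ with $C(x,z)\cap C(x,z')=\{x\}$ for different $z,z'\in E$, such that $S(x,E)$ carries the finest topology making all inclusions $C(x,z)\hookrightarrow S(x,E)$ continuous. $U$ is star-finite if every closed star in $U$ has a finite end set. **Local convexity structure.** A local convexity structure (atlas) on a topological space $Y$ is an open covering $\mathfrak V$ of $Y$ by convexity spaces $V\in\mathfrak V$ (with the induced topology) such that every convex open subspace of each $V\in\mathfrak V$ belongs to $\mathfrak V$ (as a convexity space). $A\subset Y$ is convex if $A\cap V$ is convex in $V$ for all $V\in\mathfrak V$. The convex hull $C(A)$ of $A\subset Y$ is the smallest convex set containing $A$. **Étale maps.** For a continuous map $e\colon C\to Y$ with $C$ a connected topological space, $\mathfrak V_e$ is the set of all open $U\subset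 C$ which are mapped by $e$ homeomorphically onto a convex subspace of some $V\in\mathfrak V$. $e$ is étale if $e$ is a closed map and $\mathfrak V_e$ covers $C$. $e$ is generated by $F\subset C$ if there is no closed connected subspace $A\subsetneq C$ with $F\subset A$ such that $e(U\cap A)$ is convex (in the chart $V$ in which $e(U)$ is a convex subspace) for all $U\in\mathfrak V_e$. **Geodesic manifold.** A geodesic manifold is a Hausdorff space $Y$ with a local convexity structure $\mathfrak V$ such that: (G1) for every finite $F\subset Y$, the closure of $C(F)$ is compact; (G2) if an étale map $e\colon C\to Y$ with $C$ compact is generated by $\{x,y\}\subset C$, then every connected set $A\subset C$ with $x,y\in A$ equals $C$. It is a geodesic $q$-manifold if, in addition, every $V\in\mathfrak V$ is star-finite and regular as a topological space. *)

theory Defs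
  imports "HOL-Analysis.Analysis"
begin

section \<open>Convexity spaces\<close>

text \<open>The sets \<open>Pow W\<close> with \<open>W\<close> open are closed under finite intersections, so they form a
  basis of the topology they generate. Its carrier is \<open>Pow (topspace X)\<close>.\<close>

definition powerset_topology :: "'a topology \<Rightarrow> 'a set topology" where
  "powerset_topology X = topology_generated_by {Pow W | W. openin X W}"

definition convex_in :: "'a set \<Rightarrow> ('a \<Rightarrow> 'a \<Rightarrow> 'a set) \<Rightarrow> 'a set \<Rightarrow> bool" where
  "convex_in V K A \<longleftrightarrow> A \<subseteq> V \<and> (\<forall>x\<in>A. \<forall>y\<in>A. K x y \<subseteq> A)"

text \<open>Only the values of \<open>K\<close> on \<open>topspace X\<close> matter; continuity includes
  \<open>K x y \<subseteq> topspace X\<close> for \<open>x\<close> and \<open>y\<close> in \<open>topspace X\<close>.\<close>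

definition convexity_space :: "'a topology \<Rightarrow> ('a \<Rightarrow> 'a \<Rightarrow> 'a set) \<Rightarrow> bool" where
  "convexity_space X K \<longleftrightarrow>
     Hausdorff_space X \<and>
     continuous_map (prod_topology X X) (powerset_topology X) (\<lambda>(x, y). K x y) \<and>
     (\<forall>x\<in>topspace X. \<forall>y\<in>topspace X. convex_in (topspace X) K (K x y)) \<and>
     (\<forall>x\<in>topspace X. \<forall>y\<in>topspace X.
        connectedin X (K x y) \<and> x \<in> K x y \<and> y \<in> K x y \<and>
        (\<forall>B. connectedin X B \<and> x \<in> B \<and> y \<in> B \<and> B \<subseteq> K x y \<longrightarrow> B = K x y)) \<and>
     (\<exists>\<B>. (\<forall>B\<in>\<B>. openin X B \<and> convex_in (topspace X) K B) \<and>
          openin X = arbitrary union_of (\<lambda>B. B \<in> \<B>))"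

definition star_set :: "('a \<Rightarrow> 'a \<Rightarrow> 'a set) \<Rightarrow> 'a \<Rightarrow> 'a set \<Rightarrow> 'a set" where
  "star_set K x E = (\<Union>z\<in>E. K x z)"

text \<open>The subspace topology always makes the inclusions of the \<open>K x z\<close> continuous, so the last
  conjunct says that it is the finest topology with this property.\<close>

definition is_star :: "'a topology \<Rightarrow> ('a \<Rightarrow> 'a \<Rightarrow> 'a set) \<Rightarrow> 'a \<Rightarrow> 'a set \<Rightarrow> bool" where
  "is_star X K x E \<longleftrightarrow>
     x \<in> topspace X \<and> E \<subseteq> topspace X - {x} \<and>
     (\<forall>z\<in>E. \<forall>z'\<in>E. z \<noteq> z' \<longrightarrow> K x z \<inter> K x z' = {x}) \<and>
     (\<forall>T. topspace T = star_set K x E \<and>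
          (\<forall>z\<in>E. continuous_map (subtopology X (K x z)) T (\<lambda>u. u)) \<longrightarrow>
          (\<forall>A. openin T A \<longrightarrow> openin (subtopology X (star_set K x E)) A))"

definition star_finite :: "'a topology \<Rightarrow> ('a \<Rightarrow> 'a \<Rightarrow> 'a set) \<Rightarrow> bool" where
  "star_finite X K \<longleftrightarrow>
     (\<forall>x E. is_star X K x E \<and> closedin X (star_set K x E) \<longrightarrow> finite E)"


section \<open>Local convexity structures\<close>

text \<open>A chart is an open set with its convexity map, whose values outside the set are
  irrelevant; hence the closure condition on the atlas asks for the restricted map only up to
  agreement on the smaller set. Several convexity maps on one set are not excluded.\<close>

type_synonym 'a chart = "'a set \<times> ('a \<Rightarrow> 'a \<Rightarrow> 'a set)"

definition local_convexity_structure :: "'a topology \<Rightarrow> 'a chart set \<Rightarrow> bool" where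
  "local_convexity_structure Y \<V> \<longleftrightarrow>
     (\<forall>(V, K)\<in>\<V>. openin Y V \<and> convexity_space (subtopology Y V) K) \<and>
     (\<Union>(V, K)\<in>\<V>. V) = topspace Y \<and>
     (\<forall>(V, K)\<in>\<V>. \<forall>W. openin Y W \<and> convex_in V K W \<longrightarrow>
        (\<exists>K'. (W, K') \<in> \<V> \<and> (\<forall>x\<in>W. \<forall>y\<in>W. K' x y = K x y)))"

definition locally_convex_set :: "'a topology \<Rightarrow> 'a chart set \<Rightarrow> 'a set \<Rightarrow> bool" where
  "locally_convex_set Y \<V> A \<longleftrightarrow>
     A \<subseteq> topspace Y \<and> (\<forall>(V, K)\<in>\<V>. convex_in V K (A \<inter> V))"

definition lc_hull :: "'a topology \<Rightarrow> 'a chart set \<Rightarrow> 'a set \<Rightarrow> 'a set" where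
  "lc_hull Y \<V> A = locally_convex_set Y \<V> hull A"


section \<open>Etale maps\<close>

definition etale_charts ::
  "'b topology \<Rightarrow> 'a topology \<Rightarrow> 'a chart set \<Rightarrow> ('b \<Rightarrow> 'a) \<Rightarrow> 'b set set" where
  "etale_charts C Y \<V> e =
     {U. openin C U \<and> (\<exists>(V, K)\<in>\<V>. convex_in V K (e ` U)) \<and>
         homeomorphic_map (subtopology C U) (subtopology Y (e ` U)) e}"

text \<open>The flag \<open>sep\<close> fixes the convention for domains of etale maps: arbitrary connected spaces
  (\<open>sep = False\<close>) or connected Hausdorff spaces (\<open>sep = True\<close>). It matters because, for a segment
  \<open>L\<close> with an inner point \<open>p\<close>, the projection to \<open>L\<close> of the non-Hausdorff space obtained by
  multiplying \<open>p\<close> is closed and locally a homeomorphism.\<close>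

definition etale_map ::
  "bool \<Rightarrow> 'b topology \<Rightarrow> 'a topology \<Rightarrow> 'a chart set \<Rightarrow> ('b \<Rightarrow> 'a) \<Rightarrow> bool" where
  "etale_map sep C Y \<V> e \<longleftrightarrow>
     connected_space C \<and> (sep \<longrightarrow> Hausdorff_space C) \<and>
     continuous_map C Y e \<and> closed_map C Y e \<and>
     \<Union>(etale_charts C Y \<V> e) = topspace C"

definition etale_generated ::
  "'b topology \<Rightarrow> 'a topology \<Rightarrow> 'a chart set \<Rightarrow> ('b \<Rightarrow> 'a) \<Rightarrow> 'b set \<Rightarrow> bool" where
  "etale_generated C Y \<V> e F \<longleftrightarrow>
     F \<subseteq> topspace C \<and>
     \<not> (\<exists>A. closedin C A \<and> connectedin C A \<and> A \<noteq> topspace C \<and> F \<subseteq> A \<and>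
          (\<forall>U\<in>etale_charts C Y \<V> e. \<forall>(V, K)\<in>\<V>.
             convex_in V K (e ` U) \<longrightarrow> convex_in V K (e ` (U \<inter> A))))"


section \<open>Geodesic manifolds\<close>

text \<open>In the second axiom the compact domain \<open>C\<close> ranges over topologies on \<open>'a \<times> nat\<close>. This is no
  restriction: \<open>C\<close> is a finite union of sets on which the map is injective, so it can be copied
  to a subset of \<open>'a \<times> nat\<close>. Lemma \<open>geodesic_manifold_G2\<close> below gives the axiom for domains of
  any type.\<close>

definition geodesic_manifold :: "bool \<Rightarrow> 'a topology \<Rightarrow> 'a chart set \<Rightarrow> bool" where
  "geodesic_manifold sep Y \<V> \<longleftrightarrow>
     Hausdorff_space Y \<and> local_convexity_structure Y \<V> \<and>
     (\<forall>F. finite F \<and> F \<subseteq> topspace Y \<longrightarrow> compactin Y (Y closure_of lc_hull Y \<V> F)) \<and>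
     (\<forall>(C :: ('a \<times> nat) topology) e x y.
        etale_map sep C Y \<V> e \<and> compact_space C \<and> etale_generated C Y \<V> e {x, y} \<longrightarrow>
        (\<forall>A. connectedin C A \<and> x \<in> A \<and> y \<in> A \<longrightarrow> A = topspace C))"

definition geodesic_q_manifold :: "bool \<Rightarrow> 'a topology \<Rightarrow> 'a chart set \<Rightarrow> bool" where
  "geodesic_q_manifold sep Y \<V> \<longleftrightarrow>
     geodesic_manifold sep Y \<V> \<and>
     (\<forall>(V, K)\<in>\<V>. star_finite (subtopology Y V) K \<and> regular_space (subtopology Y V))"

lemma etale_charts_pullback:
  assumes g: "homeomorphic_map C' C g" and U: "U \<in> etale_charts C Y \<V> e"
  shows "{c \<in> topspace C'. g c \<in> U} \<in> etale_charts C' Y \<V> (e \<circ> g)"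
proof -
  let ?U = "{c \<in> topspace C'. g c \<in> U}"
  have oU: "openin C U" and cU: "\<exists>(V, K)\<in>\<V>. convex_in V K (e ` U)"
    and hU: "homeomorphic_map (subtopology C U) (subtopology Y (e ` U)) e"
    using U by (auto simp: etale_charts_def)
  have surj: "g ` topspace C' = topspace C"
    using g by (simp add: homeomorphic_imp_surjective_map)
  have gU: "g ` ?U = U"
    using openin_subset[OF oU] unfolding surj[symmetric] by auto
  have o: "openin C' ?U"
    by (rule openin_continuous_map_preimage[OF homeomorphic_imp_continuous_map[OF g] oU])
  have "homeomorphic_map (subtopology C' ?U) (subtopology C U) g"
    by (rule homeomorphic_map_subtopologies_alt[OF g]) auto
  then have "homeomorphic_map (subtopology C' ?U) (subtopology Y (e ` U)) (e \<circ> g)"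
    by (rule homeomorphic_map_compose[OF _ hU])
  moreover have "(e \<circ> g) ` ?U = e ` U"
    by (simp only: image_comp[symmetric] gU)
  ultimately show ?thesis
    using o cU by (simp add: etale_charts_def del: image_comp o_apply)
qed

lemma etale_map_pullback:
  assumes g: "homeomorphic_map C' C g" and e: "etale_map sep C Y \<V> e"
  shows "etale_map sep C' Y \<V> (e \<circ> g)"
proof -
  have hs: "C' homeomorphic_space C"
    using g homeomorphic_map_imp_homeomorphic_space by blast
  have surj: "g ` topspace C' = topspace C"
    using g by (simp add: homeomorphic_imp_surjective_map)
  have "topspace C' \<subseteq> \<Union>(etale_charts C' Y \<V> (e \<circ> g))"
  proof
    fix c assume c: "c \<in> topspace C'"
    then obtain U where "U \<in> etale_charts C Y \<V> e" "g c \<in> U"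
      using e surj by (auto simp: etale_map_def)
    then show "c \<in> \<Union>(etale_charts C' Y \<V> (e \<circ> g))"
      using etale_charts_pullback[OF g] c by blast
  qed
  moreover have "\<Union>(etale_charts C' Y \<V> (e \<circ> g)) \<subseteq> topspace C'"
    by (auto simp: etale_charts_def dest: openin_subset)
  moreover have "connected_space C'" "sep \<longrightarrow> Hausdorff_space C'"
    using e homeomorphic_connected_space[OF hs] homeomorphic_Hausdorff_space[OF hs]
    by (auto simp: etale_map_def)
  moreover have "continuous_map C' Y (e \<circ> g)" "closed_map C' Y (e \<circ> g)"
    using e continuous_map_compose[OF homeomorphic_imp_continuous_map[OF g]]
      closed_map_compose[OF homeomorphic_imp_closed_map[OF g]] by (auto simp: etale_map_def)
  ultimately show ?thesis
    by (auto simp: etale_map_def)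
qed

lemma etale_generated_pullback:
  assumes g: "homeomorphic_map C' C g" and F: "F \<subseteq> topspace C'"
    and gen: "etale_generated C Y \<V> e (g ` F)"
  shows "etale_generated C' Y \<V> (e \<circ> g) F"
  unfolding etale_generated_def
proof (intro conjI notI F, elim exE conjE)
  fix A
  assume A: "closedin C' A" "connectedin C' A" "A \<noteq> topspace C'" "F \<subseteq> A"
    and conv: "\<forall>U\<in>etale_charts C' Y \<V> (e \<circ> g). \<forall>(V, K)\<in>\<V>.
      convex_in V K ((e \<circ> g) ` U) \<longrightarrow> convex_in V K ((e \<circ> g) ` (U \<inter> A))"
  have surj: "g ` topspace C' = topspace C" and inj: "inj_on g (topspace C')"
    using g by (auto simp: homeomorphic_imp_surjective_map homeomorphic_imp_injective_map)
  have sub: "A \<subseteq> topspace C'"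
    using A closedin_subset by blast
  have "closedin C (g ` A)" "connectedin C (g ` A)"
    using homeomorphic_map_closedness[OF g sub] homeomorphic_map_connectedness[OF g sub] A by auto
  moreover have "g ` A \<noteq> topspace C"
    using A(3) sub surj inj by (metis inj_on_image_eq_iff subset_refl)
  moreover have "convex_in V K (e ` (U \<inter> g ` A))"
    if U: "U \<in> etale_charts C Y \<V> e" and V: "(V, K) \<in> \<V>" and cU: "convex_in V K (e ` U)"
    for U V K
  proof -
    let ?U = "{c \<in> topspace C'. g c \<in> U}"
    have "U \<subseteq> topspace C"
      using U by (auto simp: etale_charts_def dest: openin_subset)
    then have "g ` ?U = U" "g ` (?U \<inter> A) = U \<inter> g ` A"
      using sub unfolding surj[symmetric] by auto
    moreover from conv have "convex_in V K (e ` g ` ?U) \<longrightarrow> convex_in V K (e ` g ` (?U \<inter> A))"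
      using etale_charts_pullback[OF g U] V by (simp only: image_comp) blast
    ultimately show ?thesis
      using cU by simp
  qed
  ultimately show False
    using gen A(4) unfolding etale_generated_def by blast
qed

lemma geodesic_manifold_G2:
  fixes C :: "'b topology" and Y :: "'a topology"
  assumes Y: "geodesic_manifold sep Y \<V>" and e: "etale_map sep C Y \<V> e"
    and C: "compact_space C" and gen: "etale_generated C Y \<V> e {x, y}"
    and A: "connectedin C A" "x \<in> A" "y \<in> A"
  shows "A = topspace C"
proof -
  have "\<forall>U\<in>etale_charts C Y \<V> e. openin C U" "\<Union>(etale_charts C Y \<V> e) = topspace C"
    using e by (auto simp: etale_charts_def etale_map_def)
  then obtain \<U> where fin: "finite \<U>" and \<U>: "\<U> \<subseteq> etale_charts C Y \<V> e"
    and cov: "topspace C \<subseteq> \<Union>\<U>"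
    using C[unfolded compact_space_alt, rule_format, of "etale_charts C Y \<V> e"] by auto
  obtain f :: "'b set \<Rightarrow> nat" where f: "inj_on f \<U>"
    using fin finite_imp_inj_to_nat_seg by metis
  define u where "u c = (SOME U. U \<in> \<U> \<and> c \<in> U)" for c
  have u: "u c \<in> \<U> \<and> c \<in> u c" if "c \<in> topspace C" for c
    unfolding u_def by (rule someI_ex) (use cov that in blast)
  define h where "h c = (e c, f (u c))" for c
  have inj: "inj_on h (topspace C)"
  proof (rule inj_onI)
    fix c d assume c: "c \<in> topspace C" and d: "d \<in> topspace C" and "h c = h d"
    then have ed: "e c = e d" and ud: "u c = u d"
      using u f by (auto simp: h_def inj_on_def)
    have "u c \<in> etale_charts C Y \<V> e"
      using u[OF c] \<U> by blast
    then have "inj_on e (topspace C \<inter> u c)"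
      using homeomorphic_imp_injective_map by (fastforce simp: etale_charts_def)
    then show "c = d"
      using ed ud u c d by (metis IntI inj_onD)
  qed
  define g where "g = inv_into (topspace C) h"
  define C' where "C' = pullback_topology (h ` topspace C) g C"
  have gh: "g (h c) = c" if "c \<in> topspace C" for c
    using inj that by (simp add: g_def)
  have top: "topspace C' = h ` topspace C"
    using gh by (auto simp: C'_def topspace_pullback_topology)
  have "homeomorphic_maps C' C g h"
    unfolding homeomorphic_maps_def
  proof (intro conjI)
    show "continuous_map C' C g"
      using continuous_map_pullback[OF continuous_map_id, of "h ` topspace C" g C]
      by (simp add: C'_def)
    show "continuous_map C C' h"
      unfolding C'_def
    proof (rule continuous_map_pullback')
      show "continuous_map C C (g \<circ> h)"
        by (rule continuous_map_eq[OF continuous_map_id]) (simp add: gh)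
    qed auto
  qed (use gh top in auto)
  then have g: "homeomorphic_map C' C g" and h: "homeomorphic_map C C' h"
    using homeomorphic_maps_map by blast+
  have xy: "x \<in> topspace C" "y \<in> topspace C" and AC: "A \<subseteq> topspace C"
    using A connectedin_subset_topspace by blast+
  have "etale_generated C' Y \<V> (e \<circ> g) {h x, h y}"
    by (rule etale_generated_pullback[OF g]) (use xy top gh gen in auto)
  moreover have "compact_space C'"
    using C g homeomorphic_map_imp_homeomorphic_space homeomorphic_compact_space by blast
  moreover have "connectedin C' (h ` A)"
    using homeomorphic_map_connectedness[OF h AC] A by simp
  moreover have "etale_map sep C' Y \<V> (e \<circ> g)"
    using etale_map_pullback[OF g e] .
  moreover have "\<forall>(C :: ('a \<times> nat) topology) e x y.
      etale_map sep C Y \<V> e \<and> compact_space C \<and> etale_generated C Y \<V> e {x, y} \<longrightarrow>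
      (\<forall>A. connectedin C A \<and> x \<in> A \<and> y \<in> A \<longrightarrow> A = topspace C)"
    using Y unfolding geodesic_manifold_def by (elim conjE)
  ultimately have "h ` A = topspace C'"
    using imageI[OF A(2), of h] imageI[OF A(3), of h] by meson
  then show ?thesis
    using top inj AC by (metis inj_on_image_eq_iff subset_refl)
qed

end

theory Submission
  imports Defs "HOL-Library.Ramsey"
begin

text \<open>
  Segments of a convexity space are compact, since convex open sets trace out intervals on them;
  hence closures of convex sets are convex, and (G1) and (G2) identify every segment with the closed
  hull of its end points. In particular overlapping charts have the same segments.

  If domains of etale maps may be non-Hausdorff, doubling an end point of a segment contradicts (G2),
  so there are no proper segments and a connected domain is a point.

  For Hausdorff \<open>C\<close>, unique lifting of segments and closedness of \<open>e\<close> show that the preimage of a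
  small convex neighbourhood of \<open>y\<close> is a disjoint union of sheets, one around each point of the
  fibre. In each sheet choose a short segment starting in the fibre. By regularity these lifts are
  locally finite over the chart, so any union of closed subsets of them has closed image. An infinite
  fibre would then give an infinite closed star at \<open>y\<close>, or an infinite closed discrete subset of one
  segment.
\<close>

section \<open>Segments in convexity spaces\<close>

text \<open>Suppose \<open>insert w P\<close> splits into disjoint closed sets \<open>E\<close> and
  \<open>D\<close> with \<open>w \<in> E\<close>. Then \<open>D = P - E\<close> is open in
  \<open>X\<close>; it is also closed in \<open>X\<close>, because \<open>insert w P\<close> is the
  complement of \<open>Q\<close>. A clopen set omitting \<open>w\<close> must be empty.\<close>

lemma connectedin_insert_cut_point:
  assumes X: "connected_space X" and w: "w \<in> topspace X"
    and P: "openin X P" and Q: "openin X Q" and dj: "P \<inter> Q = {}"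
    and PQ: "P \<union> Q = topspace X - {w}"
  shows "connectedin X (insert w P)"
proof -
  have eq: "insert w P = topspace X - Q"
    using w dj PQ by auto
  then have cl: "closedin X (insert w P)"
    using Q by (simp add: closedin_diff)
  have split: False
    if E: "closedin X E" "closedin X D" "E \<union> D = insert w P" "E \<inter> D = {}" "w \<in> E" "D \<noteq> {}" for E D
  proof -
    have "D = P - E"
      using E by auto
    then have "openin X D"
      using P E by (simp add: openin_diff)
    then have "D = topspace X"
      using X E(2,6) by (auto simp: connected_space_clopen_in)
    then show False
      using w E by blast
  qed
  have "connected_space (subtopology X (insert w P))"
    unfolding connected_space_closedin_eq
  proof (intro notI, elim exE conjE)
    fix E D
    assume "closedin (subtopology X (insert w P)) E" "closedin (subtopology X (insert w P)) D"
      and *: "E \<union> D = topspace (subtopology X (insert w P))" "E \<inter> D = {}" "E \<noteq> {}" "D \<noteq> {}"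
    then have "closedin X E" "closedin X D"
      using cl closedin_trans_full by blast+
    moreover have "E \<union> D = insert w P"
      using * closedin_subset[OF cl] by auto
    ultimately show False
      using split[of E D] split[of D E] * by (metis Int_commute Un_commute UnE insertI1)
  qed
  then show ?thesis
    using closedin_subset[OF cl] by (simp add: connectedin_def)
qed

lemma connected_space_sing_not_open:
  assumes "connected_space X" "t1_space X" "w \<in> topspace X" "v \<in> topspace X" "v \<noteq> w"
  shows "\<not> openin X {w}"
  using assms connected_space_clopen_in[of X] closedin_t1_singleton[of X w] by auto

context
  fixes X :: "'a topology" and K :: "'a \<Rightarrow> 'a \<Rightarrow> 'a set"
  assumes cs: "convexity_space X K"
begin

lemma convexity_space_Hausdorff: "Hausdorff_space X"
  using cs by (auto simp: convexity_space_def)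

lemma segment_connected: "a \<in> topspace X \<Longrightarrow> b \<in> topspace X \<Longrightarrow> connectedin X (K a b)"
  and segment_left: "a \<in> topspace X \<Longrightarrow> b \<in> topspace X \<Longrightarrow> a \<in> K a b"
  and segment_right: "a \<in> topspace X \<Longrightarrow> b \<in> topspace X \<Longrightarrow> b \<in> K a b"
  and segment_subset: "a \<in> topspace X \<Longrightarrow> b \<in> topspace X \<Longrightarrow> K a b \<subseteq> topspace X"
  using cs by (auto simp: convexity_space_def convex_in_def)

lemma segment_minimal:
  "a \<in> topspace X \<Longrightarrow> b \<in> topspace X \<Longrightarrow> connectedin X B \<Longrightarrow> a \<in> B \<Longrightarrow> b \<in> B \<Longrightarrow> B \<subseteq> K a b \<Longrightarrow> B = K a b"
  using cs by (simp add: convexity_space_def)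

lemma segment_convex:
  "a \<in> topspace X \<Longrightarrow> b \<in> topspace X \<Longrightarrow> s \<in> K a b \<Longrightarrow> t \<in> K a b \<Longrightarrow> K s t \<subseteq> K a b"
  using cs by (simp add: convexity_space_def convex_in_def)

lemma convex_open_neighbourhood:
  assumes "openin X W" "x \<in> W"
  obtains N where "openin X N" "convex_in (topspace X) K N" "x \<in> N" "N \<subseteq> W"
proof -
  obtain \<B> where \<B>: "\<forall>B\<in>\<B>. openin X B \<and> convex_in (topspace X) K B"
    and un: "openin X = arbitrary union_of (\<lambda>B. B \<in> \<B>)"
    using cs by (auto simp: convexity_space_def)
  have "(arbitrary union_of (\<lambda>B. B \<in> \<B>)) W"
    using assms un by simp
  then obtain \<U> where "\<U> \<subseteq> \<B>" "\<Union>\<U> = W"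
    by (auto simp: union_of_def arbitrary_def)
  with \<B> assms that show ?thesis
    by (metis Union_iff Union_upper subsetD)
qed

text \<open>This unfolds continuity into the power set topology: the preimage of the basic open set
  \<open>Pow W\<close> is open and contains a box around \<open>(a, b)\<close>.\<close>

lemma segment_upper_semicontinuous:
  assumes "a \<in> topspace X" "b \<in> topspace X" "openin X W" "K a b \<subseteq> W"
  obtains G H where "openin X G" "openin X H" "a \<in> G" "b \<in> H"
    "\<And>s t. s \<in> G \<Longrightarrow> t \<in> H \<Longrightarrow> K s t \<subseteq> W"
proof -
  let ?A = "{p \<in> topspace (prod_topology X X). (\<lambda>(x, y). K x y) p \<in> Pow W}"
  have "continuous_map (prod_topology X X) (powerset_topology X) (\<lambda>(x, y). K x y)"
    using cs by (simp add: convexity_space_def)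
  moreover have "openin (powerset_topology X) (Pow W)"
    unfolding powerset_topology_def by (rule topology_generated_by_Basis) (use assms in auto)
  ultimately have "openin (prod_topology X X) ?A"
    by (rule openin_continuous_map_preimage)
  moreover have "(a, b) \<in> ?A"
    using assms by simp
  ultimately obtain G H where "openin X G" "openin X H" "a \<in> G" "b \<in> H" "G \<times> H \<subseteq> ?A"
    unfolding openin_prod_topology_alt by meson
  then show ?thesis
    by (intro that[of G H]) auto
qed

text \<open>Minimality of \<open>K a b\<close> makes \<open>K a b - {w}\<close> disconnected. A side
  containing both end points would, together with \<open>w\<close>, be a smaller connected set
  through \<open>a\<close> and \<open>b\<close>. So \<open>w\<close> separates \<open>a\<close> from
  \<open>b\<close>, as in an interval.\<close>

lemma segment_cut:
  assumes ab: "a \<in> topspace X" "b \<in> topspace X" and w: "w \<in> K a b" "w \<noteq> a" "w \<noteq> b"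
  obtains P Q where "openin (subtopology X (K a b)) P" "openin (subtopology X (K a b)) Q"
    "P \<inter> Q = {}" "P \<union> Q = K a b - {w}" "a \<in> P" "b \<in> Q"
    "connectedin X (insert w P)" "connectedin X (insert w Q)"
proof -
  let ?L = "subtopology X (K a b)"
  have top: "topspace ?L = K a b"
    using segment_subset[OF ab] by auto
  have con: "connected_space ?L"
    using segment_connected[OF ab] by (simp add: connectedin_def)
  have ins: "connectedin X (insert w P)"
    if "openin ?L P" "openin ?L Q" "P \<inter> Q = {}" "P \<union> Q = K a b - {w}" for P Q
    using connectedin_insert_cut_point[OF con _ that(1,2,3)] that w top
    by (auto simp: connectedin_subtopology)
  have t1: "t1_space ?L"
    using convexity_space_Hausdorff by (simp add: Hausdorff_imp_t1_space t1_space_subtopology)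
  then have op: "openin ?L (K a b - {w})"
    using top w by (metis openin_topspace t1_space_openin_delete_alt)
  have side: "\<not> {a, b} \<subseteq> P"
    if "openin ?L P" "openin ?L Q" "P \<inter> Q = {}" "P \<union> Q = K a b - {w}" "Q \<noteq> {}" for P Q
  proof
    assume "{a, b} \<subseteq> P"
    then have "insert w P = K a b"
      using segment_minimal[OF ab ins[OF that(1-4)]] that w by auto
    then show False
      using that by blast
  qed
  have "\<not> connectedin ?L (K a b - {w})"
    using segment_minimal[OF ab, of "K a b - {w}"] segment_left[OF ab] segment_right[OF ab] w
    by (auto simp: connectedin_subtopology)
  then obtain P Q where PQ: "openin ?L P" "openin ?L Q" "K a b - {w} \<subseteq> P \<union> Q"
    "P \<inter> Q \<inter> (K a b - {w}) = {}" "P \<inter> (K a b - {w}) \<noteq> {}" "Q \<inter> (K a b - {w}) \<noteq> {}"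
    unfolding connectedin using top by auto
  define P' Q' where "P' = P \<inter> (K a b - {w})" and "Q' = Q \<inter> (K a b - {w})"
  have o: "openin ?L P'" "openin ?L Q'"
    unfolding P'_def Q'_def using PQ op by blast+
  have s: "P' \<inter> Q' = {}" "P' \<union> Q' = K a b - {w}" "P' \<noteq> {}" "Q' \<noteq> {}"
    using PQ unfolding P'_def Q'_def by auto
  have s': "Q' \<inter> P' = {}" "Q' \<union> P' = K a b - {w}"
    using s by auto
  have i: "connectedin X (insert w P')" "connectedin X (insert w Q')"
    using ins[OF o s(1,2)] ins[OF o(2,1) s'] by auto
  have "\<not> {a, b} \<subseteq> P'" "\<not> {a, b} \<subseteq> Q'"
    using side[OF o s(1,2,4)] side[OF o(2,1) s' s(3)] by auto
  moreover have "a \<in> P' \<union> Q'" "b \<in> P' \<union> Q'"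
    using s w segment_left[OF ab] segment_right[OF ab] by auto
  ultimately consider "a \<in> P'" "b \<in> Q'" | "a \<in> Q'" "b \<in> P'"
    by blast
  then show ?thesis
    using that[of P' Q'] that[of Q' P'] o s s' i by metis
qed

text \<open>Let \<open>w\<close> be a point of \<open>K a t\<close> outside \<open>B\<close>.
  Cutting at \<open>w\<close> puts \<open>B\<close> on the side \<open>P\<close> of
  \<open>a\<close>. The connected set \<open>K a t \<union> insert w Q\<close> joins
  \<open>a\<close> to \<open>b\<close> and is therefore all of \<open>K a b\<close>, so
  \<open>B\<close> lies in \<open>K a t\<close> and minimality of \<open>K a t\<close> gives
  equality. The cut needs \<open>w\<close> to differ from \<open>b\<close>; for \<open>w = b\<close>
  already \<open>K a t = K a b\<close>.\<close>

lemma initial_segment_subset: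
  assumes ab: "a \<in> topspace X" "b \<in> topspace X"
    and B: "connectedin X B" "B \<subseteq> K a b" "a \<in> B" "t \<in> B"
  shows "K a t \<subseteq> B"
proof
  fix w assume w: "w \<in> K a t"
  have t: "t \<in> topspace X" "t \<in> K a b"
    using B segment_subset[OF ab] by auto
  have sub: "K a t \<subseteq> K a b"
    using segment_convex[OF ab segment_left[OF ab] t(2)] .
  note at = segment_connected[OF ab(1) t(1)] segment_left[OF ab(1) t(1)]
  show "w \<in> B"
  proof (rule ccontr)
    assume nB: "w \<notin> B"
    show False
    proof (cases "w = b")
      case True
      then have "K a t = K a b"
        using segment_minimal[OF ab at(1,2)] w sub by blast
      then have "B = K a t"
        using segment_minimal[OF ab(1) t(1) B(1,3,4)] B(2) by simp
      then show False
        using w nB by simp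
    next
      case False
      obtain P Q where PQ: "openin (subtopology X (K a b)) P" "openin (subtopology X (K a b)) Q"
        "P \<inter> Q = {}" "P \<union> Q = K a b - {w}" "a \<in> P" "b \<in> Q" "connectedin X (insert w Q)"
        by (rule segment_cut[OF ab, of w]) (use w sub nB B(3) False in auto)
      have "connectedin (subtopology X (K a b)) B"
        using B by (simp add: connectedin_subtopology)
      then have "Q \<inter> B = {}"
        using connectedinD[of _ B P Q] PQ B nB by blast
      then have BP: "B \<subseteq> P"
        using PQ B nB by blast
      have "connectedin X (K a t \<union> insert w Q)"
        using connectedin_Un[OF at(1) PQ(7)] w by blast
      then have "K a t \<union> insert w Q = K a b"
        by (rule segment_minimal[OF ab]) (use at PQ sub w in auto)
      then have "B \<subseteq> K a t"
        using BP PQ nB by blast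
      then show False
        using segment_minimal[OF ab(1) t(1) B(1,3,4)] w nB by simp
    qed
  qed
qed

text \<open>The points \<open>t\<close> for which \<open>K a t\<close> is finitely covered form a clopen subset of the segment.\<close>

lemma segment_compact:
  assumes ab: "a \<in> topspace X" "b \<in> topspace X"
  shows "compactin X (K a b)"
  unfolding compactin_def
proof (intro conjI allI impI)
  show "K a b \<subseteq> topspace X"
    by (rule segment_subset[OF ab])
  fix \<U> assume \<U>: "(\<forall>U\<in>\<U>. openin X U) \<and> K a b \<subseteq> \<Union>\<U>"
  let ?L = "subtopology X (K a b)"
  define fc where "fc A \<longleftrightarrow> (\<exists>\<F>. finite \<F> \<and> \<F> \<subseteq> \<U> \<and> A \<subseteq> \<Union>\<F>)" for A
  define S where "S = {t \<in> K a b. fc (K a t)}"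
  have top: "topspace ?L = K a b"
    using segment_subset[OF ab] by auto
  \<comment> \<open>The union of \<open>K a u\<close> and \<open>K u v\<close> is connected, so it
    contains \<open>K a v\<close>; one more member of the cover suffices.\<close>
  have ext: "fc (K a v)" if u: "u \<in> S" and v: "v \<in> K a b"
    and N: "K u v \<subseteq> U" "U \<in> \<U>" for u v U
  proof -
    have uv: "u \<in> topspace X" "v \<in> topspace X" "u \<in> K a b"
      using u v segment_subset[OF ab] by (auto simp: S_def)
    obtain \<F> where \<F>: "finite \<F>" "\<F> \<subseteq> \<U>" "K a u \<subseteq> \<Union>\<F>"
      using u by (auto simp: S_def fc_def)
    have "connectedin X (K a u \<union> K u v)"
      by (rule connectedin_Un[OF segment_connected segment_connected])
        (use segment_left[OF uv(1,2)] segment_right[OF ab(1) uv(1)] ab uv in auto)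
    moreover have "K a u \<union> K u v \<subseteq> K a b"
      using segment_convex[OF ab] segment_left[OF ab] uv v by blast
    ultimately have "K a v \<subseteq> K a u \<union> K u v"
      by (rule initial_segment_subset[OF ab])
        (use segment_left[OF ab(1) uv(1)] segment_right[OF uv(1,2)] in auto)
    also have "\<dots> \<subseteq> \<Union>(insert U \<F>)"
      using \<F> N by auto
    finally show ?thesis
      unfolding fc_def using \<F> N by (metis finite_insert insert_subset)
  qed
  \<comment> \<open>A convex \<open>N\<close> inside a member \<open>U\<close> allows
    \<open>ext\<close> in both directions between points of \<open>N\<close>. Hence \<open>S\<close>
    and its complement are both open.\<close>
  have nbhd: "\<exists>N U. openin X N \<and> U \<in> \<U> \<and> t \<in> N \<and> (\<forall>u\<in>N. \<forall>v\<in>N. K u v \<subseteq> U)"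
    if t: "t \<in> K a b" for t
  proof -
    obtain U where "U \<in> \<U>" "t \<in> U" "openin X U"
      using \<U> t by blast
    then obtain N where "openin X N" "convex_in (topspace X) K N" "t \<in> N" "N \<subseteq> U"
      using convex_open_neighbourhood by metis
    then show ?thesis
      using \<open>U \<in> \<U>\<close> unfolding convex_in_def by (meson subset_trans)
  qed
  have "openin ?L S"
  proof (subst openin_subopen, intro ballI)
    fix t assume t: "t \<in> S"
    then have "t \<in> K a b"
      by (simp add: S_def)
    then obtain N U where N: "openin X N" "U \<in> \<U>" "t \<in> N" "\<forall>u\<in>N. \<forall>v\<in>N. K u v \<subseteq> U"
      using nbhd by meson
    have "N \<inter> K a b \<subseteq> S"
      using ext[OF t _ _ N(2)] N by (auto simp: S_def)
    moreover have "openin ?L (N \<inter> K a b)"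
      using N by (simp add: openin_subtopology_Int)
    ultimately show "\<exists>T. openin ?L T \<and> t \<in> T \<and> T \<subseteq> S"
      using N t by (auto simp: S_def)
  qed
  moreover have "openin ?L (K a b - S)"
  proof (subst openin_subopen, intro ballI)
    fix t assume t: "t \<in> K a b - S"
    then obtain N U where N: "openin X N" "U \<in> \<U>" "t \<in> N" "\<forall>u\<in>N. \<forall>v\<in>N. K u v \<subseteq> U"
      using nbhd by (meson DiffD1)
    have "N \<inter> K a b \<subseteq> K a b - S"
      using ext[of _ t U] N t by (auto simp: S_def)
    moreover have "openin ?L (N \<inter> K a b)"
      using N by (simp add: openin_subtopology_Int)
    ultimately show "\<exists>T. openin ?L T \<and> t \<in> T \<and> T \<subseteq> K a b - S"
      using N t by (metis DiffD1 IntI)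
  qed
  then have "closedin ?L S"
    using top by (auto simp: closedin_def S_def)
  moreover have "a \<in> S"
  proof -
    have "K a a = {a}"
      using segment_minimal[OF ab(1,1), of "{a}"] ab segment_left[OF ab(1,1)] by simp
    then show ?thesis
      using \<U> segment_left[OF ab] unfolding S_def fc_def
      by simp (metis Union_iff empty_subsetI finite.emptyI finite_insert insert_subset
          insertI1 subsetD)
  qed
  moreover have "connected_space ?L"
    using segment_connected[OF ab] by (simp add: connectedin_def)
  ultimately have "S = K a b"
    using top unfolding connected_space_clopen_in by (metis empty_iff)
  then show "\<exists>\<F>. finite \<F> \<and> \<F> \<subseteq> \<U> \<and> K a b \<subseteq> \<Union>\<F>"
    using segment_right[OF ab] by (auto simp: S_def fc_def)
qed

text \<open>If \<open>w\<close> in \<open>K a b\<close> has a neighbourhood \<open>N\<close> missing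
  \<open>A\<close>, removing \<open>N\<close> leaves two compact pieces of the segment, one on each
  side of \<open>w\<close>, with disjoint open neighbourhoods \<open>P'\<close> and
  \<open>Q'\<close>. By semicontinuity a segment between points \<open>s\<close> and
  \<open>t\<close> of \<open>A\<close> near \<open>a\<close> and \<open>b\<close> stays in
  \<open>P' \<union> N \<union> Q'\<close>. It also lies in \<open>A\<close>, so it misses
  \<open>N\<close> and would be disconnected.\<close>

lemma closure_of_convex:
  assumes A: "convex_in (topspace X) K A"
  shows "convex_in (topspace X) K (X closure_of A)"
  unfolding convex_in_def
proof (intro conjI ballI subsetI)
  show "x \<in> topspace X" if "x \<in> X closure_of A" for x
    using that closure_of_subset_topspace by fast
  fix a b w assume a: "a \<in> X closure_of A" and b: "b \<in> X closure_of A" and w: "w \<in> K a b"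
  have ab: "a \<in> topspace X" "b \<in> topspace X"
    using a b by (auto simp: in_closure_of)
  let ?L = "subtopology X (K a b)"
  show "w \<in> X closure_of A"
  proof (rule ccontr)
    assume nw: "w \<notin> X closure_of A"
    then have "w \<noteq> a" "w \<noteq> b"
      using a b by auto
    then obtain P Q where PQ: "openin ?L P" "openin ?L Q"
      "P \<inter> Q = {}" "P \<union> Q = K a b - {w}" "a \<in> P" "b \<in> Q"
      using segment_cut[OF ab w] by metis
    define N where "N = topspace X - X closure_of A"
    have N: "openin X N" "w \<in> N" "N \<inter> A = {}"
      using nw w segment_subset[OF ab] closure_of_subset_Int[of X A] A
      by (auto simp: N_def convex_in_def)
    have cpt: "compactin X (K a b - N - R)" if "openin ?L R" for R
    proof -
      have "closedin ?L (K a b - (N \<inter> K a b) - R)"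
        using that N segment_subset[OF ab]
        by (metis closedin_diff closedin_topspace openin_subtopology_Int topspace_subtopology_subset)
      moreover have "K a b - (N \<inter> K a b) - R = K a b - N - R"
        by auto
      ultimately have "compactin ?L (K a b - N - R)"
        using segment_compact[OF ab] by (metis closedin_compact_space compact_space_subtopology)
      then show ?thesis
        by (simp add: compactin_subtopology)
    qed
    have "disjnt (K a b - N - Q) (K a b - N - P)"
      using PQ N by (auto simp: disjnt_def)
    then obtain P' Q' where o: "openin X P'" "openin X Q'" "disjnt P' Q'"
      and sub: "K a b - N - Q \<subseteq> P'" "K a b - N - P \<subseteq> Q'"
      using Hausdorff_space_compact_separation[OF convexity_space_Hausdorff cpt[OF PQ(2)] cpt[OF PQ(1)]]
      by metis
    have "K a b \<subseteq> P' \<union> N \<union> Q'"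
      using sub PQ(3) by blast
    moreover have "openin X (P' \<union> N \<union> Q')"
      using o N by blast
    ultimately obtain G H where GH: "openin X G" "openin X H" "a \<in> G" "b \<in> H"
      "\<And>s t. s \<in> G \<Longrightarrow> t \<in> H \<Longrightarrow> K s t \<subseteq> P' \<union> N \<union> Q'"
      using segment_upper_semicontinuous[OF ab] by metis
    have "a \<in> P'" "b \<in> Q'"
      using sub PQ a b segment_left[OF ab] segment_right[OF ab] by (auto simp: N_def)
    then obtain s t where st: "s \<in> A" "s \<in> G \<inter> P'" "t \<in> A" "t \<in> H \<inter> Q'"
      using a b GH o unfolding in_closure_of by (metis IntI openin_Int)
    have top: "s \<in> topspace X" "t \<in> topspace X" and "K s t \<subseteq> A"
      using A st by (auto simp: convex_in_def)
    then have "K s t \<subseteq> P' \<union> Q'"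
      using GH(5)[of s t] st N by blast
    then show False
      using connectedinD[OF segment_connected[OF top] o(1,2)] o st segment_left[OF top] segment_right[OF top]
      unfolding disjnt_def by blast
  qed
qed

end

section \<open>Infinite families of segments at a point\<close>

lemma infinite_connectedin_t1:
  assumes "connectedin X S" "t1_space X" "u \<in> S" "v \<in> S" "u \<noteq> v"
  shows "infinite S"
proof
  assume "finite S"
  have top: "topspace (subtopology X S) = S"
    using connectedin_subset_topspace[OF assms(1)] by auto
  have t1: "t1_space (subtopology X S)"
    by (rule t1_space_subtopology[OF assms(2)])
  have "subtopology X S = discrete_topology S"
    using finite_t1_space_imp_discrete_topology[OF top \<open>finite S\<close> t1] .
  then have "openin (subtopology X S) {u}"
    using assms(3) by simp
  moreover have "connected_space (subtopology X S)"
    using assms(1) by (simp add: connectedin_def)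
  ultimately show False
    using connected_space_sing_not_open[OF _ t1] top assms(3-) by metis
qed

text \<open>Greedy choice: only finitely many values are already taken, so each infinite set still
  has a free one.\<close>

lemma infinite_sets_distinct_representatives:
  assumes "\<And>n::nat. infinite (S n)"
  obtains p where "inj p" "\<And>n. p n \<in> S n"
proof -
  have "\<exists>p. \<forall>n. p n \<in> S n - p ` {..<n}"
  proof (rule dependent_wellorder_choice[where P = "\<lambda>p n r. r \<in> S n - p ` {..<n}"])
    show "\<exists>r. r \<in> S n - p ` {..<n}" for n and p :: "nat \<Rightarrow> 'a"
      using assms[of n] by (metis Diff_infinite_finite all_not_in_conv finite.emptyI
          finite_imageI finite_lessThan)
  qed (auto simp: image_iff)
  then obtain p where p: "\<And>n. p n \<in> S n - p ` {..<n}"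
    by blast
  have "p m \<noteq> p n" if "m < n" for m n
    using p[of n] that by (metis DiffD2 imageI lessThan_iff)
  then have "inj p"
    by (metis injI linorder_neqE_nat)
  then show ?thesis
    using that p by blast
qed

text \<open>The hypothesis \<open>closed\<close> is what a closed map provides when the segments lift to pairwise
  disjoint open sheets. By Ramsey's theorem, infinitely many of the segments pairwise meet only in
  \<open>y\<close> and form a closed star, or pairwise share more than \<open>y\<close>; in the latter case distinct points of
  infinitely many segments lie on one of them and form an infinite closed discrete subset of a
  compact set.\<close>

lemma star_finite_segments:
  assumes cs: "convexity_space X K" and sf: "star_finite X K" and y: "y \<in> topspace X"
    and w: "\<And>c. c \<in> F \<Longrightarrow> w c \<in> topspace X \<and> w c \<noteq> y"
    and closed: "\<And>A. (\<And>c. c \<in> F \<Longrightarrow> closedin X (A c) \<and> A c \<subseteq> K y (w c)) \<Longrightarrow>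
      closedin X (\<Union>c\<in>F. A c)"
  shows "finite F"
proof (rule ccontr)
  assume inf: "infinite F"
  define \<sigma> where "\<sigma> c = K y (w c)" for c
  \<comment> \<open>A colouring of two-element index sets in the form required by Ramsey's theorem;
    it is well defined because the condition is symmetric.\<close>
  define f where "f S = (if \<exists>c d. S = {c, d} \<and> \<sigma> c \<inter> \<sigma> d = {y} then 0 else 1 :: nat)" for S
  have f: "f {c, d} = 0 \<longleftrightarrow> \<sigma> c \<inter> \<sigma> d = {y}" for c d
    unfolding f_def by (auto simp: doubleton_eq_iff Int_commute)
  note hd = convexity_space_Hausdorff[OF cs]
  have \<sigma>: "y \<in> \<sigma> c" "w c \<in> \<sigma> c" "connectedin X (\<sigma> c)" "compactin X (\<sigma> c)" "closedin X (\<sigma> c)"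
    "\<sigma> c \<subseteq> topspace X" if "c \<in> F" for c
    unfolding \<sigma>_def using that w[OF that] y
    by (auto simp: segment_left[OF cs] segment_right[OF cs] segment_connected[OF cs]
        segment_compact[OF cs] compactin_imp_closedin[OF hd] dest: subsetD[OF segment_subset[OF cs], rotated 2])
  \<comment> \<open>A subfamily is handled by putting the empty set at the remaining
    indices.\<close>
  have closed': "closedin X (\<Union>c\<in>I. A c)"
    if "I \<subseteq> F" "\<And>c. c \<in> I \<Longrightarrow> closedin X (A c) \<and> A c \<subseteq> \<sigma> c" for I A
  proof -
    have "closedin X (\<Union>c\<in>F. if c \<in> I then A c else {})"
      by (rule closed) (use that in \<open>auto simp: \<sigma>_def\<close>)
    moreover have "(\<Union>c\<in>F. if c \<in> I then A c else {}) = (\<Union>c\<in>I. A c)"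
      using that by auto
    ultimately show ?thesis
      by simp
  qed
  obtain I t where I: "I \<subseteq> F" "infinite I" "\<And>c d. c \<in> I \<Longrightarrow> d \<in> I \<Longrightarrow> c \<noteq> d \<Longrightarrow> f {c, d} = t"
  proof -
    have "\<forall>c\<in>F. \<forall>d\<in>F. c \<noteq> d \<longrightarrow> f {c, d} < 2"
      by (simp add: f_def)
    then obtain I t where I: "I \<subseteq> F" "infinite I" "\<forall>c\<in>I. \<forall>d\<in>I. c \<noteq> d \<longrightarrow> f {c, d} = t"
      using Ramsey2[OF inf, of f 2] by auto
    show ?thesis
      by (rule that[OF I(1,2)]) (use I(3) in simp)
  qed
  show False
  proof (cases "t = 0")
    case True
    then have triv: "\<sigma> c \<inter> \<sigma> d = {y}" if "c \<in> I" "d \<in> I" "c \<noteq> d" for c d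
      using I(3)[OF that] f by simp
    have inj: "inj_on w I"
    proof (rule inj_onI, rule ccontr)
      fix c d assume cd: "c \<in> I" "d \<in> I" "w c = w d" "c \<noteq> d"
      then have "w c \<in> \<sigma> c \<inter> \<sigma> d"
        using \<sigma>(2)[of c] \<sigma>(2)[of d] I(1) by auto
      then show False
        using triv[OF cd(1,2,4)] w[of c] cd(1) I(1) by auto
    qed
    have S: "star_set K y (w ` I) = (\<Union>c\<in>I. \<sigma> c)"
      by (simp add: star_set_def \<sigma>_def)
    have "is_star X K y (w ` I)"
      unfolding is_star_def S
    proof (intro conjI y allI impI ballI)
      show "w ` I \<subseteq> topspace X - {y}"
        using w I(1) by blast
      show "K y z \<inter> K y z' = {y}" if "z \<in> w ` I" "z' \<in> w ` I" "z \<noteq> z'" for z z'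
        using that triv unfolding \<sigma>_def by auto
      fix T A
      assume T: "topspace T = (\<Union>c\<in>I. \<sigma> c) \<and>
        (\<forall>z\<in>w ` I. continuous_map (subtopology X (K y z)) T (\<lambda>u. u))" and A: "openin T A"
      \<comment> \<open>For the finest-topology condition: \<open>A\<close> has open trace on every
        segment, so the complementary traces are closed and so is their union. Its complement is an
        open set of \<open>X\<close> cutting out \<open>A\<close> on the star.\<close>
      have "closedin X (\<Union>c\<in>I. \<sigma> c - A)"
      proof (rule closed'[OF I(1)], intro conjI)
        fix c assume c: "c \<in> I"
        then have cF: "c \<in> F"
          using I(1) by blast
        have top: "topspace (subtopology X (\<sigma> c)) = \<sigma> c"
          using \<sigma>(6)[OF cF] by auto
        have "continuous_map (subtopology X (\<sigma> c)) T (\<lambda>u. u)"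
          using T c unfolding \<sigma>_def by blast
        then have "openin (subtopology X (\<sigma> c)) {u \<in> \<sigma> c. u \<in> A}"
          using openin_continuous_map_preimage[OF _ A] top by fastforce
        then have "closedin (subtopology X (\<sigma> c)) (\<sigma> c - {u \<in> \<sigma> c. u \<in> A})"
          using top by (metis closedin_diff closedin_topspace)
        moreover have "\<sigma> c - {u \<in> \<sigma> c. u \<in> A} = \<sigma> c - A"
          by auto
        ultimately show "closedin X (\<sigma> c - A)"
          using \<sigma>(5)[OF cF] closedin_trans_full by metis
      qed auto
      then have "openin X (topspace X - (\<Union>c\<in>I. \<sigma> c - A))"
        by (simp only: openin_diff openin_topspace)
      moreover have "(\<Union>c\<in>I. \<sigma> c) \<subseteq> topspace X"
        using \<sigma>(6) I(1) by blast
      then have "(topspace X - (\<Union>c\<in>I. \<sigma> c - A)) \<inter> (\<Union>c\<in>I. \<sigma> c) = A"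
        using openin_subset[OF A] T by auto
      ultimately show "openin (subtopology X (\<Union>c\<in>I. \<sigma> c)) A"
        using openin_subtopology_Int by metis
    qed
    moreover have "closedin X (star_set K y (w ` I))"
      unfolding S by (rule closed'[OF I(1)]) (use \<sigma>(5) I(1) in auto)
    ultimately have "finite (w ` I)"
      using sf unfolding star_finite_def by blast
    then show False
      using inj I(2) finite_image_iff by blast
  next
    case False
    obtain c0 where c0: "c0 \<in> I"
      using I(2) by fastforce
    have "infinite (I - {c0})"
      using I(2) by simp
    then obtain g :: "nat \<Rightarrow> 'b" where g: "inj g" "range g \<subseteq> I - {c0}"
      using infinite_countable_subset by blast
    have gF: "g n \<in> F" "g n \<in> I" "g n \<noteq> c0" for n
      using g(2) I(1) by auto
    have c0F: "c0 \<in> F"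
      using c0 I(1) by blast
    \<comment> \<open>A common point \<open>v\<close> other than \<open>y\<close> yields a common
      segment \<open>K y v\<close>, which is infinite. The fixed segment \<open>\<sigma> c0\<close>
      is the compact set in which an accumulation point will be found.\<close>
    have "infinite (\<sigma> (g n) \<inter> \<sigma> c0)" for n
    proof -
      have "\<sigma> (g n) \<inter> \<sigma> c0 \<noteq> {y}"
        using I(3)[OF gF(2) c0 gF(3)] f False by metis
      then obtain v where v: "v \<in> \<sigma> (g n)" "v \<in> \<sigma> c0" "v \<noteq> y"
        using \<sigma>(1)[OF gF(1)] \<sigma>(1)[OF c0F] by blast
      have vX: "v \<in> topspace X"
        using v(1) \<sigma>(6)[OF gF(1)] by blast
      have "infinite (K y v)"
        using infinite_connectedin_t1[OF segment_connected[OF cs y vX] Hausdorff_imp_t1_space[OF hd]]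
          segment_left[OF cs y vX] segment_right[OF cs y vX] v(3) by metis
      moreover have "K y v \<subseteq> \<sigma> (g n)" "K y v \<subseteq> \<sigma> c0"
        using segment_convex[OF cs y _ _ v(1)[unfolded \<sigma>_def]]
          segment_convex[OF cs y _ _ v(2)[unfolded \<sigma>_def]] w[OF gF(1)] w[OF c0F]
          segment_left[OF cs y] unfolding \<sigma>_def by auto
      ultimately show ?thesis
        by (meson Int_greatest finite_subset)
    qed
    then obtain p where p: "inj p" "\<And>n. p n \<in> \<sigma> (g n) \<inter> \<sigma> c0"
      using infinite_sets_distinct_representatives[of "\<lambda>n. \<sigma> (g n) \<inter> \<sigma> c0"] by metis
    have "infinite (range p)" "range p \<subseteq> \<sigma> c0"
      using p range_inj_infinite by blast+
    then obtain x where x: "x \<in> X derived_set_of (range p)"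
      using compactin_imp_Bolzano_Weierstrass[OF \<sigma>(4)[OF c0F], of "range p"] by blast
    \<comment> \<open>Each segment contributes at most one point, so the union is closed. Leaving
      out \<open>x\<close> makes its complement a neighbourhood of \<open>x\<close> that meets
      \<open>range p\<close> at most in \<open>x\<close>, although \<open>x\<close> is an
      accumulation point.\<close>
    have "closedin X (\<Union>c\<in>range g. {p n | n. g n = c \<and> p n \<noteq> x})"
    proof (rule closed')
      show "range g \<subseteq> F"
        using gF by blast
      fix c assume "c \<in> range g"
      then obtain n where n: "c = g n"
        by blast
      let ?A = "{p n | n. g n = c \<and> p n \<noteq> x}"
      have A: "?A \<subseteq> {p n}"
        using n injD[OF g(1)] by blast
      have fin: "finite ?A"
        by (rule finite_subset[OF A]) simp
      have sub: "?A \<subseteq> \<sigma> c"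
        by (rule subset_trans[OF A]) (use p(2)[of n] n in simp)
      have "\<sigma> c \<subseteq> topspace X"
        using \<sigma>(6)[OF gF(1)[of n]] n by simp
      then have "closedin X ?A"
        by (intro closedin_Hausdorff_finite[OF hd _ fin] subset_trans[OF sub])
      with sub show "closedin X ?A \<and> ?A \<subseteq> \<sigma> c"
        by simp
    qed
    moreover have "(\<Union>c\<in>range g. {p n | n. g n = c \<and> p n \<noteq> x}) = range p - {x}"
      by auto
    ultimately have "openin X (topspace X - (range p - {x}))"
      by (simp add: openin_diff)
    then show False
      using x unfolding in_derived_set_of by (metis (lifting) Diff_iff singletonD singletonI)
  qed
qed

section \<open>Segments in geodesic manifolds\<close>

lemma chart_openin:
  "local_convexity_structure Y \<V> \<Longrightarrow> (V, K) \<in> \<V> \<Longrightarrow> openin Y V"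
  and chart_convexity_space:
  "local_convexity_structure Y \<V> \<Longrightarrow> (V, K) \<in> \<V> \<Longrightarrow> convexity_space (subtopology Y V) K"
  by (auto simp: local_convexity_structure_def)

lemma chart_topspace:
  "local_convexity_structure Y \<V> \<Longrightarrow> (V, K) \<in> \<V> \<Longrightarrow> topspace (subtopology Y V) = V"
  by (rule topspace_subtopology_subset[OF openin_subset[OF chart_openin]])

context
  fixes Y :: "'a topology" and \<V> V K
  assumes lcs: "local_convexity_structure Y \<V>" and V: "(V, K) \<in> \<V>"
begin

private lemmas cs = chart_convexity_space[OF lcs V] and top = chart_topspace[OF lcs V]

lemmas chart_segment_left = segment_left[OF cs, unfolded top]
  and chart_segment_right = segment_right[OF cs, unfolded top]
  and chart_segment_subset = segment_subset[OF cs, unfolded top]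
  and chart_segment_minimal = segment_minimal[OF cs, unfolded top]

lemma chart_segment_connected: "x \<in> V \<Longrightarrow> z \<in> V \<Longrightarrow> connectedin Y (K x z)"
  using segment_connected[OF cs, unfolded top] by (simp add: connectedin_subtopology)

lemma chart_segment_compact: "x \<in> V \<Longrightarrow> z \<in> V \<Longrightarrow> compactin Y (K x z)"
  using segment_compact[OF cs, unfolded top] by (simp add: compactin_subtopology)

end

section \<open>Locally convex sets and their hulls\<close>

lemma locally_convex_setI:
  assumes "A \<subseteq> topspace Y"
    and "\<And>V K x z. (V, K) \<in> \<V> \<Longrightarrow> x \<in> A \<Longrightarrow> z \<in> A \<Longrightarrow> x \<in> V \<Longrightarrow> z \<in> V \<Longrightarrow> K x z \<subseteq> A \<inter> V"
  shows "locally_convex_set Y \<V> A"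
  using assms unfolding locally_convex_set_def convex_in_def by blast

lemma locally_convex_setD:
  assumes "locally_convex_set Y \<V> A" "(V, K) \<in> \<V>"
  shows "convex_in V K (A \<inter> V)"
  using assms unfolding locally_convex_set_def by blast

lemma locally_convex_set_segment:
  assumes "locally_convex_set Y \<V> A" "(V, K) \<in> \<V>" "x \<in> A" "z \<in> A" "x \<in> V" "z \<in> V"
  shows "K x z \<subseteq> A \<inter> V"
  using locally_convex_setD[OF assms(1,2)] assms(3-) unfolding convex_in_def by blast

lemma locally_convex_set_Inter:
  assumes "\<And>A. A \<in> \<A> \<Longrightarrow> locally_convex_set Y \<V> A" "\<A> \<noteq> {}"
  shows "locally_convex_set Y \<V> (\<Inter>\<A>)"
proof (rule locally_convex_setI)
  show "\<Inter>\<A> \<subseteq> topspace Y"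
    using assms unfolding locally_convex_set_def by blast
  fix V K x z
  assume "(V, K) \<in> \<V>" "x \<in> \<Inter>\<A>" "z \<in> \<Inter>\<A>" "x \<in> V" "z \<in> V"
  then have "K x z \<subseteq> A \<inter> V" if "A \<in> \<A>" for A
    using locally_convex_set_segment[OF assms(1)[OF that]] that by simp
  then show "K x z \<subseteq> \<Inter>\<A> \<inter> V"
    using assms(2) by blast
qed

lemma locally_convex_set_topspace:
  assumes lcs: "local_convexity_structure Y \<V>"
  shows "locally_convex_set Y \<V> (topspace Y)"
proof (rule locally_convex_setI)
  fix V K x z
  assume V: "(V, K) \<in> \<V>" and "x \<in> V" "z \<in> V"
  then show "K x z \<subseteq> topspace Y \<inter> V"
    using chart_segment_subset[OF lcs V] openin_subset[OF chart_openin[OF lcs V]] by blast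
qed simp

lemma locally_convex_set_lc_hull:
  assumes "local_convexity_structure Y \<V>" "A \<subseteq> topspace Y"
  shows "locally_convex_set Y \<V> (lc_hull Y \<V> A)"
  unfolding lc_hull_def hull_def
  by (rule locally_convex_set_Inter) (use assms locally_convex_set_topspace in auto)

lemma lc_hull_minimal: "locally_convex_set Y \<V> B \<Longrightarrow> A \<subseteq> B \<Longrightarrow> lc_hull Y \<V> A \<subseteq> B"
  unfolding lc_hull_def by (rule hull_minimal)

text \<open>Charts are open, so the trace of the closure on a chart is the closure of the trace
  within the chart. This reduces the claim to \<open>closure_of_convex\<close>.\<close>

lemma locally_convex_set_closure_of:
  assumes lcs: "local_convexity_structure Y \<V>" and A: "locally_convex_set Y \<V> A"
  shows "locally_convex_set Y \<V> (Y closure_of A)"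
proof -
  have "convex_in V K (Y closure_of A \<inter> V)" if V: "(V, K) \<in> \<V>" for V K
  proof -
    have "convex_in V K (A \<inter> V)"
      by (rule locally_convex_setD[OF A V])
    then have "convex_in V K (subtopology Y V closure_of (A \<inter> V))"
      by (rule closure_of_convex[OF chart_convexity_space[OF lcs V], unfolded chart_topspace[OF lcs V]])
    moreover have "subtopology Y V closure_of (A \<inter> V) = Y closure_of A \<inter> V"
      using chart_openin[OF lcs V] by (metis Int_commute closure_of_subtopology_open
          closure_of_subtopology Int_left_absorb)
    ultimately show ?thesis
      by simp
  qed
  then show ?thesis
    unfolding locally_convex_set_def using closure_of_subset_topspace by fastforce
qed

text \<open>The component \<open>Q\<close> of \<open>x\<close> in the hull is itself locally convex,
  since chart segments issuing from \<open>Q\<close> stay in the hull and are connected. It contains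
  \<open>z\<close> through the segment \<open>K x z\<close>, so minimality of the hull makes it
  everything.\<close>

lemma connectedin_lc_hull_pair:
  assumes lcs: "local_convexity_structure Y \<V>" and V: "(V, K) \<in> \<V>" and xz: "x \<in> V" "z \<in> V"
  shows "connectedin Y (lc_hull Y \<V> {x, z})"
proof -
  define H where "H = lc_hull Y \<V> {x, z}"
  define Q where "Q = connected_component_of_set (subtopology Y H) x"
  have Hsub: "{x, z} \<subseteq> H"
    unfolding H_def lc_hull_def by (rule hull_subset)
  have H: "locally_convex_set Y \<V> H"
    unfolding H_def using chart_openin[OF lcs V] openin_subset xz
    by (intro locally_convex_set_lc_hull[OF lcs]) blast
  have step: "K' a b \<subseteq> Q" if V': "(V', K') \<in> \<V>" and a: "a \<in> Q \<inter> V'" and b: "b \<in> H \<inter> V'" for V' K' a b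
  proof
    fix c assume c: "c \<in> K' a b"
    have aH: "a \<in> H"
      using a connected_component_of_subset_topspace[of "subtopology Y H" x]
      by (auto simp: Q_def)
    have "connectedin Y (K' a b)" "a \<in> K' a b"
      using chart_segment_connected[OF lcs V'] chart_segment_left[OF lcs V'] a b by auto
    moreover have "K' a b \<subseteq> H"
      using locally_convex_set_segment[OF H V' aH] a b by blast
    ultimately have "connected_component_of (subtopology Y H) a c"
      using c unfolding connected_component_of_def by (auto simp: connectedin_subtopology)
    moreover have "connected_component_of (subtopology Y H) x a"
      using a by (simp add: Q_def)
    ultimately show "c \<in> Q"
      unfolding Q_def using connected_component_of_trans by fastforce
  qed
  have QH: "Q \<subseteq> H"
    using connected_component_of_subset_topspace[of "subtopology Y H" x] by (auto simp: Q_def)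
  have QY: "Q \<subseteq> topspace Y"
    using connected_component_of_subset_topspace[of "subtopology Y H" x] by (auto simp: Q_def)
  have "locally_convex_set Y \<V> Q"
  proof (rule locally_convex_setI[OF QY])
    fix V' K' a b
    assume V': "(V', K') \<in> \<V>" and ab: "a \<in> Q" "b \<in> Q" "a \<in> V'" "b \<in> V'"
    show "K' a b \<subseteq> Q \<inter> V'"
      using step[OF V', of a b] QH chart_segment_subset[OF lcs V' ab(3,4)] ab by blast
  qed
  moreover have "x \<in> Q"
    using Hsub xz chart_openin[OF lcs V] openin_subset unfolding Q_def
    by (auto simp: connected_component_of_refl)
  moreover from this have "z \<in> Q"
    using step[OF V, of x z] xz Hsub chart_segment_right[OF lcs V] by auto
  ultimately have "H \<subseteq> Q"
    unfolding H_def by (intro lc_hull_minimal) auto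
  then have "H = Q"
    using QH by simp
  moreover have "connectedin Y Q"
    using connectedin_connected_component_of[of "subtopology Y H" x]
    by (auto simp: Q_def connectedin_subtopology)
  ultimately show ?thesis
    by (simp add: H_def)
qed

section \<open>Consequences of (G1) and (G2) for segments\<close>

lemma geodesic_manifold_Hausdorff: "geodesic_manifold sep Y \<V> \<Longrightarrow> Hausdorff_space Y"
  unfolding geodesic_manifold_def by (elim conjE)

lemma geodesic_manifold_structure:
  "geodesic_manifold sep Y \<V> \<Longrightarrow> local_convexity_structure Y \<V>"
  unfolding geodesic_manifold_def by (elim conjE)

lemma geodesic_manifold_G1:
  assumes "geodesic_manifold sep Y \<V>" "finite F" "F \<subseteq> topspace Y"
  shows "compactin Y (Y closure_of lc_hull Y \<V> F)"
proof -
  have "\<forall>F. finite F \<and> F \<subseteq> topspace Y \<longrightarrow> compactin Y (Y closure_of lc_hull Y \<V> F)"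
    using assms(1) unfolding geodesic_manifold_def by (elim conjE)
  then show ?thesis
    using assms(2,3) by blast
qed

text \<open>By (G2), the inclusion of the closed hull of \<open>{x, z}\<close> forces the hull to be a segment; in
  particular overlapping charts have the same segments.\<close>

lemma segment_eq_closed_hull:
  assumes Y: "geodesic_manifold sep Y \<V>" and V: "(V, K) \<in> \<V>" and xz: "x \<in> V" "z \<in> V"
  shows "K x z = Y closure_of lc_hull Y \<V> {x, z}"
proof -
  note lcs = geodesic_manifold_structure[OF Y] and hd = geodesic_manifold_Hausdorff[OF Y]
  have xzY: "{x, z} \<subseteq> topspace Y"
    using xz chart_openin[OF lcs V] openin_subset by blast
  define H where "H = lc_hull Y \<V> {x, z}"
  define L where "L = Y closure_of H"
  define C where "C = subtopology Y L"
  have L: "locally_convex_set Y \<V> L" "closedin Y L" "connectedin Y L"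
    unfolding L_def H_def
    using locally_convex_set_closure_of[OF lcs locally_convex_set_lc_hull[OF lcs xzY]]
      connectedin_closure_of[OF connectedin_lc_hull_pair[OF lcs V xz]] by auto
  have top: "topspace C = L"
    using closedin_subset[OF L(2)] by (auto simp: C_def)
  have HL: "H \<subseteq> L" "{x, z} \<subseteq> H"
    unfolding L_def H_def using locally_convex_set_lc_hull[OF lcs xzY]
    by (auto simp: locally_convex_set_def closure_of_subset lc_hull_def hull_inc)
  \<comment> \<open>Local convexity of \<open>L\<close> makes its traces on the charts of
    \<open>Y\<close> chart domains of the inclusion.\<close>
  have chart: "L \<inter> V' \<in> etale_charts C Y \<V> (\<lambda>u. u)" "convex_in V' K' (L \<inter> V')"
    if V': "(V', K') \<in> \<V>" for V' K'
  proof -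
    show cv: "convex_in V' K' (L \<inter> V')"
      by (rule locally_convex_setD[OF L(1) V'])
    have "subtopology C (L \<inter> V') = subtopology Y (L \<inter> V')"
      by (simp add: C_def subtopology_subtopology)
    then show "L \<inter> V' \<in> etale_charts C Y \<V> (\<lambda>u. u)"
      using cv V' chart_openin[OF lcs V']
      by (auto simp: etale_charts_def C_def openin_subtopology_Int2 homeomorphic_map_id[unfolded id_def])
  qed
  have "etale_map sep C Y \<V> (\<lambda>u. u)"
    unfolding etale_map_def
  proof (intro conjI)
    show "connected_space C" "sep \<longrightarrow> Hausdorff_space C"
      using L hd by (auto simp: C_def connectedin_def Hausdorff_space_subtopology)
    show "continuous_map C Y (\<lambda>u. u)"
      by (simp add: C_def continuous_map_from_subtopology)
    show "closed_map C Y (\<lambda>u. u)"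
      using L closedin_trans_full by (fastforce simp: closed_map_def C_def)
    show "\<Union>(etale_charts C Y \<V> (\<lambda>u. u)) = topspace C"
    proof
      show "\<Union>(etale_charts C Y \<V> (\<lambda>u. u)) \<subseteq> topspace C"
        by (auto simp: etale_charts_def dest: openin_subset)
      show "topspace C \<subseteq> \<Union>(etale_charts C Y \<V> (\<lambda>u. u))"
      proof
        fix c assume c: "c \<in> topspace C"
        then have "c \<in> (\<Union>(V, K)\<in>\<V>. V)"
          using lcs by (auto simp: local_convexity_structure_def C_def)
        then obtain V' K' where "(V', K') \<in> \<V>" "c \<in> V'"
          by auto
        then show "c \<in> \<Union>(etale_charts C Y \<V> (\<lambda>u. u))"
          using chart(1) c top by blast
      qed
    qed
  qed
  moreover have "compact_space C"
    using geodesic_manifold_G1[OF Y _ xzY] unfolding C_def L_def H_def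
    by (simp add: compact_space_subtopology)
  \<comment> \<open>A smaller admissible \<open>A\<close>, tested on the chart domains
    \<open>L \<inter> V'\<close>, is locally convex. Being closed and containing \<open>x\<close>
    and \<open>z\<close>, it contains \<open>H\<close> and then \<open>L\<close>.\<close>
  moreover have "etale_generated C Y \<V> (\<lambda>u. u) {x, z}"
    unfolding etale_generated_def
  proof (intro conjI notI, goal_cases)
    case 1
    show ?case
      using HL top by auto
  next
    case 2
    then obtain A where A: "closedin C A" "A \<noteq> topspace C" "{x, z} \<subseteq> A"
      and cv: "\<forall>U\<in>etale_charts C Y \<V> (\<lambda>u. u). \<forall>(V, K)\<in>\<V>.
             convex_in V K ((\<lambda>u. u) ` U) \<longrightarrow> convex_in V K ((\<lambda>u. u) ` (U \<inter> A))"
      by blast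
    have AL: "A \<subseteq> L"
      using closedin_subset[OF A(1)] top by simp
    have clA: "closedin Y A"
      using closedin_trans_full[OF A(1)[unfolded C_def] L(2)] .
    have "convex_in V' K' (A \<inter> V')" if V': "(V', K') \<in> \<V>" for V' K'
    proof -
      have "convex_in V' K' (L \<inter> V' \<inter> A)"
        using cv[rule_format, OF chart(1)[OF V'], of "(V', K')"] V' chart(2)[OF V'] by simp
      moreover have "L \<inter> V' \<inter> A = A \<inter> V'"
        using AL by auto
      ultimately show ?thesis
        by simp
    qed
    then have "locally_convex_set Y \<V> A"
      using closedin_subset[OF clA] unfolding locally_convex_set_def by blast
    then have "H \<subseteq> A"
      unfolding H_def using A by (intro lc_hull_minimal)
    then have "L \<subseteq> A"
      unfolding L_def using clA by (simp add: closure_of_minimal)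
    then show False
      using A AL top by simp
  qed
  \<comment> \<open>The segment is the connected set to which (G2) is applied.\<close>
  moreover have "connectedin C (K x z)" "x \<in> K x z" "z \<in> K x z"
  proof -
    show "x \<in> K x z" "z \<in> K x z"
      using chart_segment_left[OF lcs V] chart_segment_right[OF lcs V] xz by auto
    have "K x z \<subseteq> L"
      using locally_convex_set_segment[OF L(1) V] HL xz by blast
    then show "connectedin C (K x z)"
      using chart_segment_connected[OF lcs V xz] by (auto simp: C_def connectedin_subtopology)
  qed
  ultimately have "K x z = topspace C"
    by (rule geodesic_manifold_G2[OF Y])
  then show ?thesis
    by (simp add: top L_def H_def)
qed

text \<open>Doubling the end point \<open>x\<close> of a segment gives a compact non-Hausdorff domain generated by two
  points from which the second copy of \<open>x\<close> can be removed, against (G2).\<close>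

lemma non_separated_charts_trivial:
  assumes Y: "geodesic_manifold False Y \<V>" and V: "(V, K) \<in> \<V>" and xz: "x \<in> V" "z \<in> V"
  shows "x = z"
proof (rule ccontr)
  assume ne: "x \<noteq> z"
  note lcs = geodesic_manifold_structure[OF Y] and hd = geodesic_manifold_Hausdorff[OF Y]
  define L where "L = K x z"
  define LT where "LT = subtopology Y L"
  \<comment> \<open>The boolean tag survives only at \<open>x\<close>, so the two copies of the
    segment are glued everywhere else.\<close>
  define \<phi> :: "bool \<Rightarrow> 'a \<Rightarrow> 'a \<times> bool" where "\<phi> i u = (u, i \<and> u = x)" for i u
  define M where "M = \<phi> False ` L \<union> \<phi> True ` L"
  \<comment> \<open>The final topology for the two maps \<open>\<phi> i\<close>.\<close>
  define C where "C = topology (\<lambda>S. S \<subseteq> M \<and> (\<forall>i. openin LT {u \<in> L. \<phi> i u \<in> S}))"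
  have L: "x \<in> L" "z \<in> L" "L \<subseteq> V" "connectedin Y L" "compactin Y L" "closedin Y L"
    unfolding L_def
    by (rule chart_segment_left[OF lcs V xz] chart_segment_right[OF lcs V xz]
        chart_segment_subset[OF lcs V xz] chart_segment_connected[OF lcs V xz]
        chart_segment_compact[OF lcs V xz]
        compactin_imp_closedin[OF hd chart_segment_compact[OF lcs V xz]])+
  have topL: "topspace LT = L"
    unfolding LT_def using closedin_subset[OF L(6)] by auto
  have conL: "connected_space LT"
    using L(4) by (simp add: LT_def connectedin_def)
  have "istopology (\<lambda>S. S \<subseteq> M \<and> (\<forall>i. openin LT {u \<in> L. \<phi> i u \<in> S}))"
    unfolding istopology_def
  proof (intro conjI allI impI; (elim conjE)?)
    fix S T i
    assume "\<forall>i. openin LT {u \<in> L. \<phi> i u \<in> S}" "\<forall>i. openin LT {u \<in> L. \<phi> i u \<in> T}"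
    moreover have "{u \<in> L. \<phi> i u \<in> S \<inter> T} = {u \<in> L. \<phi> i u \<in> S} \<inter> {u \<in> L. \<phi> i u \<in> T}"
      by auto
    ultimately show "openin LT {u \<in> L. \<phi> i u \<in> S \<inter> T}"
      by (metis (lifting) openin_Int)
  next
    fix \<S> i
    assume "\<forall>S\<in>\<S>. S \<subseteq> M \<and> (\<forall>i. openin LT {u \<in> L. \<phi> i u \<in> S})"
    moreover have "{u \<in> L. \<phi> i u \<in> \<Union>\<S>} = (\<Union>S\<in>\<S>. {u \<in> L. \<phi> i u \<in> S})"
      by auto
    ultimately show "openin LT {u \<in> L. \<phi> i u \<in> \<Union>\<S>}"
      by auto
  qed auto
  then have openC: "openin C S \<longleftrightarrow> S \<subseteq> M \<and> (\<forall>i. openin LT {u \<in> L. \<phi> i u \<in> S})" for S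
    by (simp add: C_def topology_inverse')
  have \<phi>M: "\<phi> i u \<in> M" if "u \<in> L" for i u
    using that by (cases i) (auto simp: M_def)
  have "{u \<in> L. \<phi> i u \<in> M} = topspace LT" for i
    using \<phi>M topL by auto
  then have "openin C M"
    by (simp add: openC)
  then have topC: "topspace C = M"
    using openC[of "topspace C"] openin_subset[of C M] by auto
  have closedC: "closedin LT {u \<in> L. \<phi> i u \<in> A}" if "closedin C A" for i A
  proof -
    have "openin C (M - A)"
      using that topC by (metis closedin_def)
    then have "openin LT {u \<in> L. \<phi> i u \<in> M - A}"
      by (simp add: openC)
    moreover have "{u \<in> L. \<phi> i u \<in> M - A} = topspace LT - {u \<in> L. \<phi> i u \<in> A}"
      using \<phi>M topL by auto
    ultimately show ?thesis
      using topL by (simp add: closedin_def)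
  qed
  have cont_\<phi>: "continuous_map LT C (\<phi> i)" for i
    unfolding continuous_map_def topL topC using \<phi>M openC by auto
  have cont_fst: "continuous_map C LT fst"
    unfolding continuous_map_def topL topC
  proof (intro conjI allI impI)
    show "fst \<in> M \<rightarrow> L"
      by (auto simp: M_def \<phi>_def)
    fix G assume G: "openin LT G"
    have "{u \<in> L. \<phi> i u \<in> {c \<in> M. fst c \<in> G}} = G" for i
      using openin_subset[OF G] topL \<phi>M by (auto simp: \<phi>_def)
    then show "openin C {c \<in> M. fst c \<in> G}"
      unfolding openC using G by auto
  qed
  have fst_\<phi>: "fst ` \<phi> i ` L = L" for i
    by (auto simp: \<phi>_def image_image)
  \<comment> \<open>Each copy is open: its preimage under the other map is the segment without
    \<open>x\<close>, which is open because points are closed.\<close>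
  have U: "\<phi> i ` L \<in> etale_charts C Y \<V> fst" for i
  proof -
    have "openin LT {u \<in> L. \<phi> j u \<in> \<phi> i ` L}" for j
    proof (cases "i = j")
      case True
      then have "{u \<in> L. \<phi> j u \<in> \<phi> i ` L} = topspace LT"
        using topL by auto
      then show ?thesis
        by simp
    next
      case False
      then have "{u \<in> L. \<phi> j u \<in> \<phi> i ` L} = topspace LT - {x}"
        using topL by (auto simp: \<phi>_def)
      moreover have "t1_space LT"
        using hd by (simp add: LT_def Hausdorff_imp_t1_space t1_space_subtopology)
      ultimately show ?thesis
        by (metis openin_topspace t1_space_openin_delete_alt)
    qed
    then have "openin C (\<phi> i ` L)"
      unfolding openC using \<phi>M by auto
    moreover have "homeomorphic_maps (subtopology C (\<phi> i ` L)) LT fst (\<phi> i)"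
      unfolding homeomorphic_maps_def
      using cont_fst cont_\<phi> topL
      by (auto simp: continuous_map_from_subtopology continuous_map_in_subtopology \<phi>_def)
    then have "homeomorphic_map (subtopology C (\<phi> i ` L)) (subtopology Y L) fst"
      unfolding LT_def by (rule homeomorphic_maps_imp_map)
    moreover have "convex_in V K L"
      using chart_convexity_space[OF lcs V] chart_topspace[OF lcs V] xz
      unfolding convexity_space_def L_def by metis
    ultimately show ?thesis
      using V unfolding etale_charts_def mem_Collect_eq fst_\<phi> by blast
  qed
  have con: "connectedin C (\<phi> i ` L)" and cpt: "compactin C (\<phi> i ` L)" for i
    using connectedin_continuous_map_image[OF cont_\<phi>[of i], of L]
      image_compactin[OF _ cont_\<phi>[of i], of L] conL L topL
    by (auto simp: LT_def connectedin_subtopology compactin_subtopology)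
  have "\<phi> False z \<in> \<phi> False ` L \<inter> \<phi> True ` L"
    using L ne by (auto simp: \<phi>_def image_iff)
  then have "connectedin C M"
    unfolding M_def by (intro connectedin_Un con) blast
  have "etale_map False C Y \<V> fst"
    unfolding etale_map_def
  proof (intro conjI)
    show "connected_space C"
      using \<open>connectedin C M\<close> topC by (metis connectedin_topspace)
    show "continuous_map C Y fst"
      using cont_fst by (simp add: LT_def continuous_map_in_subtopology)
    show "closed_map C Y fst"
      unfolding closed_map_def
    proof (intro allI impI)
      fix A assume A: "closedin C A"
      have "fst ` A = {u \<in> L. \<phi> False u \<in> A} \<union> {u \<in> L. \<phi> True u \<in> A}"
        using closedin_subset[OF A] unfolding topC M_def by (force simp: \<phi>_def image_iff)
      then have "closedin LT (fst ` A)"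
        using closedC[OF A] by (simp add: closedin_Un)
      then show "closedin Y (fst ` A)"
        unfolding LT_def using L(6) closedin_trans_full by blast
    qed
    show "\<Union>(etale_charts C Y \<V> fst) = topspace C"
    proof
      show "\<Union>(etale_charts C Y \<V> fst) \<subseteq> topspace C"
        by (auto simp: etale_charts_def dest: openin_subset)
      show "topspace C \<subseteq> \<Union>(etale_charts C Y \<V> fst)"
        unfolding topC M_def using U by blast
    qed
  qed simp
  moreover have "compact_space C"
    unfolding compact_space_def topC M_def by (intro compactin_Un cpt)
  moreover have "etale_generated C Y \<V> fst {\<phi> False x, \<phi> False z}"
    unfolding etale_generated_def
  proof (intro conjI notI, goal_cases)
    case 1
    show ?case
      using \<phi>M L topC by auto
  next
    case 2
    then obtain A where A: "closedin C A" "connectedin C A" "A \<noteq> topspace C"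
      "\<phi> False x \<in> A" "\<phi> False z \<in> A"
      by auto
    \<comment> \<open>Minimality of the segment makes the image of \<open>A\<close> all of
      \<open>L\<close>. Points other than \<open>x\<close> have a single preimage, so only the
      copies of \<open>x\<close> could be missing from \<open>A\<close>.\<close>
    have "connectedin LT (fst ` A)"
      by (rule connectedin_continuous_map_image[OF cont_fst A(2)])
    then have "connectedin (subtopology Y V) (fst ` A)" "fst ` A \<subseteq> L"
      using L(3) by (auto simp: LT_def connectedin_subtopology)
    moreover have "x \<in> fst ` A" "z \<in> fst ` A"
      using A by (force simp: \<phi>_def)+
    ultimately have "fst ` A = L"
      unfolding L_def using chart_segment_minimal[OF lcs V xz] by simp
    then have off: "\<phi> i u \<in> A" if "u \<in> L" "u \<noteq> x" for i u
      using that closedin_subset[OF A(1)] unfolding topC M_def \<phi>_def by force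
    \<comment> \<open>A missing copy would make \<open>L - {x}\<close> closed and \<open>{x}\<close>
      open in the connected space \<open>L\<close>.\<close>
    have "\<phi> i x \<in> A" for i
    proof (rule ccontr)
      assume "\<phi> i x \<notin> A"
      then have "{u \<in> L. \<phi> i u \<in> A} = topspace LT - {x}"
        using off topL by auto
      then have "openin LT {x}"
        using closedC[OF A(1), of i] topL L(1)
        by (metis closedin_def double_diff insert_subset empty_subsetI subset_refl)
      moreover have "t1_space LT"
        using hd by (simp add: LT_def Hausdorff_imp_t1_space t1_space_subtopology)
      ultimately show False
        using connected_space_sing_not_open[OF conL _ _ _ ne[symmetric]] topL L by blast
    qed
    then have "M \<subseteq> A"
      unfolding M_def using off by blast
    then show False
      using A(3) closedin_subset[OF A(1)] topC by simp
  qed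
  \<comment> \<open>The first copy is connected and contains both generators, yet omits
    \<open>\<phi> True x\<close>; this contradicts (G2).\<close>
  ultimately have "\<phi> False ` L = topspace C"
    by (rule geodesic_manifold_G2[OF Y]) (use con L in auto)
  then have "\<phi> True x \<in> \<phi> False ` L"
    using \<phi>M[OF L(1)] topC by simp
  then show False
    by (auto simp: \<phi>_def)
qed

section \<open>Fibres of etale maps\<close>

lemma convex_in_Int: "convex_in V K A \<Longrightarrow> convex_in V K B \<Longrightarrow> convex_in V K (A \<inter> B)"
  by (auto simp: convex_in_def)

text \<open>Uniqueness of lifts: the inverse sections \<open>s\<close> and \<open>s'\<close> over
  \<open>S\<close> agree on a closed set because \<open>C\<close> is Hausdorff, and on an open set
  because agreement at \<open>t\<close> amounts to \<open>s t \<in> U'\<close>. They agree at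
  \<open>e q\<close>, hence on all of \<open>S\<close>.\<close>

lemma connected_sections_agree:
  assumes hd: "Hausdorff_space C"
    and U: "openin C U" "homeomorphic_map (subtopology C U) (subtopology Y (e ` U)) e"
    and U': "openin C U'" "homeomorphic_map (subtopology C U') (subtopology Y (e ` U')) e"
    and S: "connectedin Y S" "S \<subseteq> e ` U" "S \<subseteq> e ` U'"
    and q: "q \<in> U" "q \<in> U'" "e q \<in> S" and c: "c \<in> U" "e c \<in> S"
  shows "c \<in> U'"
proof -
  obtain s where s: "homeomorphic_maps (subtopology C U) (subtopology Y (e ` U)) e s"
    using U(2) homeomorphic_map_maps by blast
  obtain s' where s': "homeomorphic_maps (subtopology C U') (subtopology Y (e ` U')) e s'"
    using U'(2) homeomorphic_map_maps by blast
  have UC: "topspace (subtopology C U) = U" "topspace (subtopology C U') = U'"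
    using openin_subset[OF U(1)] openin_subset[OF U'(1)] by auto
  have inv: "s (e u) = u" if "u \<in> U" for u
    using s that UC unfolding homeomorphic_maps_def by simp
  have inv': "s' (e u) = u" if "u \<in> U'" for u
    using s' that UC unfolding homeomorphic_maps_def by simp
  let ?S = "subtopology Y S"
  have top: "topspace ?S = S"
    using connectedin_subset_topspace[OF S(1)] by auto
  have cont: "continuous_map ?S C s" "continuous_map ?S C s'"
    using s s' S(2,3) unfolding homeomorphic_maps_def
    by (metis continuous_map_from_subtopology_mono continuous_map_in_subtopology)+
  define E where "E = {t \<in> topspace ?S. s t \<in> U'}"
  have "E = {t \<in> topspace ?S. s t = s' t}"
  proof -
    have "s t \<in> U' \<longleftrightarrow> s t = s' t" if "t \<in> S" for t
      using that S(2,3) inv inv' by (metis imageE subsetD)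
    then show ?thesis
      unfolding E_def top by blast
  qed
  then have "closedin ?S E"
    using closedin_continuous_maps_eq[OF hd cont] by simp
  moreover have "openin ?S E"
    unfolding E_def by (rule openin_continuous_map_preimage[OF cont(1) U'(1)])
  moreover have "connected_space ?S"
    using S(1) by (simp add: connectedin_def)
  moreover have "e q \<in> E"
    using q inv top by (simp add: E_def)
  ultimately have "E = S"
    unfolding connected_space_clopen_in using top by (metis empty_iff)
  then show ?thesis
    using c inv[OF c(1)] unfolding E_def by force
qed

text \<open>Every chart of \<open>Y\<close> has at most one point and \<open>e\<close> is injective
  on chart domains, so \<open>C\<close> is discrete. Being connected, it has at most one
  point.\<close>

lemma etale_fibre_finite_nonseparated:
  assumes Y: "geodesic_manifold False Y \<V>" and e: "etale_map sep C Y \<V> e"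
  shows "finite {c \<in> topspace C. e c = y}"
proof -
  have op: "openin C {c}" if c: "c \<in> topspace C" for c
  proof -
    obtain U where U: "U \<in> etale_charts C Y \<V> e" "c \<in> U"
      using e c unfolding etale_map_def by blast
    then obtain V K where V: "(V, K) \<in> \<V>" "e ` U \<subseteq> V"
      unfolding etale_charts_def convex_in_def by blast
    have oU: "openin C U" and "homeomorphic_map (subtopology C U) (subtopology Y (e ` U)) e"
      using U(1) unfolding etale_charts_def by blast+
    then have "inj_on e U"
      using homeomorphic_imp_injective_map openin_subset[OF oU] by (metis topspace_subtopology_subset)
    then have "U = {c}"
      using U(2) V(2) non_separated_charts_trivial[OF Y V(1)] unfolding inj_on_def by blast
    then show ?thesis
      using oU by simp
  qed
  have "topspace C \<subseteq> {c}" if c: "c \<in> topspace C" for c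
  proof -
    have "openin C (\<Union>d\<in>topspace C - {c}. {d})"
      using op by blast
    then have "closedin C {c}"
      using c by (simp add: closedin_def)
    then show ?thesis
      using op[OF c] e unfolding etale_map_def connected_space_clopen_in by blast
  qed
  then have "finite (topspace C)"
    by (metis finite.emptyI finite.insertI finite_subset subsetI empty_subsetI)
  then show ?thesis
    by simp
qed

text \<open>The conclusion comes from \<open>star_finite_segments\<close>. Its closedness hypothesis
  is verified in \<open>C\<close>, where the lifted segments lie in disjoint sheets, and then pushed
  down by the closed map \<open>e\<close>.\<close>

lemma etale_fibre_finite_Hausdorff:
  assumes Y: "geodesic_q_manifold sep Y \<V>" and e: "etale_map sep C Y \<V> e"
    and hC: "Hausdorff_space C" and y: "y \<in> topspace Y"
  shows "finite {c \<in> topspace C. e c = y}"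
proof (rule ccontr)
  define F where "F = {c \<in> topspace C. e c = y}"
  assume "infinite {c \<in> topspace C. e c = y}"
  then have inf: "infinite F"
    by (simp add: F_def)
  have gm: "geodesic_manifold sep Y \<V>"
    using Y by (simp add: geodesic_q_manifold_def)
  note lcs = geodesic_manifold_structure[OF gm] and hY = geodesic_manifold_Hausdorff[OF gm]
  have con: "connected_space C" and cont: "continuous_map C Y e" and clo: "closed_map C Y e"
    and cov: "\<Union>(etale_charts C Y \<V> e) = topspace C"
    using e unfolding etale_map_def by blast+
  have "y \<in> (\<Union>(V, K)\<in>\<V>. V)"
    using lcs y unfolding local_convexity_structure_def by blast
  then obtain V K where V: "(V, K) \<in> \<V>" "y \<in> V"
    by blast
  note cs = chart_convexity_space[OF lcs V(1)] and topV = chart_topspace[OF lcs V(1)]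
    and oV = chart_openin[OF lcs V(1)]
  have sf: "star_finite (subtopology Y V) K" and reg: "regular_space (subtopology Y V)"
    using Y V(1) unfolding geodesic_q_manifold_def by blast+
  \<comment> \<open>All sheets are compared in the single chart \<open>(V, K)\<close> around
    \<open>y\<close>.\<close>
  define good where "good U \<longleftrightarrow> openin C U \<and> convex_in V K (e ` U) \<and>
    homeomorphic_map (subtopology C U) (subtopology Y (e ` U)) e" for U
  have restrict: "openin C {u \<in> U. e u \<in> W}"
    "homeomorphic_map (subtopology C {u \<in> U. e u \<in> W}) (subtopology Y (e ` {u \<in> U. e u \<in> W})) e"
    if U: "openin C U" "homeomorphic_map (subtopology C U) (subtopology Y (e ` U)) e"
    and W: "openin Y W" for U W
  proof -
    have "{u \<in> U. e u \<in> W} = U \<inter> {u \<in> topspace C. e u \<in> W}"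
      using openin_subset[OF U(1)] by auto
    then show "openin C {u \<in> U. e u \<in> W}"
      using U(1) openin_continuous_map_preimage[OF cont W] by (metis openin_Int)
    have "homeomorphic_map (subtopology (subtopology C U) {u. e u \<in> W})
        (subtopology (subtopology Y (e ` U)) W) e"
      by (rule homeomorphic_map_subtopologies_alt[OF U(2)]) simp
    moreover have "U \<inter> {u. e u \<in> W} = {u \<in> U. e u \<in> W}" "e ` U \<inter> W = e ` {u \<in> U. e u \<in> W}"
      by auto
    ultimately show "homeomorphic_map (subtopology C {u \<in> U. e u \<in> W})
        (subtopology Y (e ` {u \<in> U. e u \<in> W})) e"
      by (simp add: subtopology_subtopology)
  qed
  have "\<exists>U. good U \<and> c \<in> U" if c: "c \<in> F" for c
  proof -
    have cC: "c \<in> topspace C" and ec: "e c = y"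
      using c by (auto simp: F_def)
    obtain U where U: "U \<in> etale_charts C Y \<V> e" "c \<in> U"
      using cov cC by blast
    then obtain V' K' where V': "(V', K') \<in> \<V>" "convex_in V' K' (e ` U)"
      unfolding etale_charts_def by blast
    have oU: "openin C U" and hU: "homeomorphic_map (subtopology C U) (subtopology Y (e ` U)) e"
      using U(1) unfolding etale_charts_def by blast+
    have oV': "openin Y V'"
      by (rule chart_openin[OF lcs V'(1)])
    have yV': "y \<in> V'"
      using V'(2) U(2) ec unfolding convex_in_def by blast
    \<comment> \<open>The image of \<open>U\<close> is known to be convex only in \<open>V'\<close>.
      Over a convex \<open>W\<close> inside \<open>V \<inter> V'\<close> both charts have the same
      segments, by \<open>segment_eq_closed_hull\<close>, so convexity carries over to
      \<open>V\<close>.\<close>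
    have "openin (subtopology Y V') (V \<inter> V')"
      using oV by (simp add: openin_subtopology_Int)
    then obtain W where W: "openin (subtopology Y V') W" "convex_in V' K' W" "y \<in> W" "W \<subseteq> V \<inter> V'"
      using convex_open_neighbourhood[OF chart_convexity_space[OF lcs V'(1)], unfolded chart_topspace[OF lcs V'(1)]]
        V(2) yV' by (metis IntI)
    have oW: "openin Y W"
      using W(1) oV' openin_trans_full by blast
    have img: "e ` {u \<in> U. e u \<in> W} = e ` U \<inter> W"
      by auto
    have "K a b \<subseteq> e ` U \<inter> W" if "a \<in> e ` U \<inter> W" "b \<in> e ` U \<inter> W" for a b
    proof -
      have "K' a b \<subseteq> e ` U \<inter> W"
        using that V'(2) W(2) unfolding convex_in_def by blast
      moreover have "a \<in> V" "b \<in> V" "a \<in> V'" "b \<in> V'"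
        using that W(4) by blast+
      then have "K a b = K' a b"
        using segment_eq_closed_hull[OF gm V(1)] segment_eq_closed_hull[OF gm V'(1)] by metis
      ultimately show ?thesis
        by simp
    qed
    then have "convex_in V K (e ` U \<inter> W)"
      using W(4) unfolding convex_in_def by blast
    then have "good {u \<in> U. e u \<in> W}"
      unfolding good_def img using restrict[OF oU hU oW] unfolding img by blast
    moreover have "c \<in> {u \<in> U. e u \<in> W}"
      using U(2) W(3) ec by simp
    ultimately show ?thesis
      by blast
  qed
  then obtain U0 where U0: "\<And>c. c \<in> F \<Longrightarrow> good (U0 c)" "\<And>c. c \<in> F \<Longrightarrow> c \<in> U0 c"
    by metis
  have "openin C (\<Union>c\<in>F. U0 c)"
    using U0(1) unfolding good_def by blast
  moreover have "{c \<in> topspace C. e c = y} \<subseteq> (\<Union>c\<in>F. U0 c)"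
    using U0(2) unfolding F_def by blast
  \<comment> \<open>Closedness of \<open>e\<close>: an open set containing the fibre contains the
    preimage of a neighbourhood of \<open>y\<close>.\<close>
  ultimately obtain G where G: "openin Y G" "y \<in> G" "{c \<in> topspace C. e c \<in> G} \<subseteq> (\<Union>c\<in>F. U0 c)"
    using clo y unfolding closed_map_fibre_neighbourhood by meson
  have "openin (subtopology Y V) (G \<inter> V)"
    using G(1) by (simp add: openin_subtopology_Int)
  then obtain N' where N': "openin (subtopology Y V) N'" "convex_in V K N'" "y \<in> N'" "N' \<subseteq> G \<inter> V"
    using convex_open_neighbourhood[OF cs, unfolded topV] G(2) V(2) by (metis IntI)
  have oN': "openin Y N'"
    using N'(1) oV openin_trans_full by blast
  \<comment> \<open>Regularity supplies a set \<open>Z\<close>, closed in \<open>V\<close>, between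
    the small neighbourhood \<open>N\<close> containing the segments and the set \<open>N'\<close>
    whose preimage is covered by sheets.\<close>
  obtain Q Z where QZ: "openin (subtopology Y V) Q" "closedin (subtopology Y V) Z" "y \<in> Q"
    "Q \<subseteq> Z" "Z \<subseteq> N'"
    using reg N'(1,3) unfolding neighbourhood_base_of_closedin[symmetric] neighbourhood_base_of by meson
  obtain N where N: "openin (subtopology Y V) N" "convex_in V K N" "y \<in> N" "N \<subseteq> Q"
    using convex_open_neighbourhood[OF cs QZ(1,3), unfolded topV] by metis
  have oN: "openin Y N"
    using N(1) oV openin_trans_full by blast
  define U where "U c = {u \<in> U0 c. e u \<in> N'}" for c
  have oU: "openin C (U c)"
    and hU: "homeomorphic_map (subtopology C (U c)) (subtopology Y (e ` U c)) e"
    and cvU: "convex_in V K (e ` U c)" and cU: "c \<in> U c" if c: "c \<in> F" for c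
  proof -
    have "openin C (U0 c)" "homeomorphic_map (subtopology C (U0 c)) (subtopology Y (e ` U0 c)) e"
      and cv: "convex_in V K (e ` U0 c)"
      using U0(1)[OF c] unfolding good_def by blast+
    from restrict[OF this(1,2) oN'] show "openin C (U c)"
      "homeomorphic_map (subtopology C (U c)) (subtopology Y (e ` U c)) e"
      unfolding U_def by blast+
    have "e ` U c = e ` U0 c \<inter> N'"
      unfolding U_def by auto
    then show "convex_in V K (e ` U c)"
      using convex_in_Int[OF cv N'(2)] by simp
    show "c \<in> U c"
      using U0(2)[OF c] N'(3) c unfolding U_def F_def by simp
  qed
  have covN': "\<exists>c\<in>F. q \<in> U c" if "q \<in> topspace C" "e q \<in> N'" for q
    using that G(3) N'(4) unfolding U_def by blast
  have segU: "K y v \<subseteq> e ` U c" if "c \<in> F" "v \<in> e ` U c" for c v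
  proof -
    have "y \<in> e ` U c"
      using cU[OF that(1)] that(1) by (auto simp: F_def)
    then show ?thesis
      using that(2) cvU[OF that(1)] unfolding convex_in_def by blast
  qed
  \<comment> \<open>At a common point \<open>q\<close>, the segment from \<open>y\<close> to
    \<open>e q\<close> lifts into both sheets. The lifts agree over \<open>e q\<close>, hence over
    \<open>y\<close>, so \<open>c\<close> lies in \<open>U d\<close>, where \<open>e\<close> is
    injective.\<close>
  have disj: "c = d" if cd: "c \<in> F" "d \<in> F" and q: "q \<in> U c" "q \<in> U d" for c d q
  proof -
    have eq: "e q \<in> V"
      using q(1) cvU[OF cd(1)] unfolding convex_in_def by blast
    have "K y (e q) \<subseteq> e ` U c" "K y (e q) \<subseteq> e ` U d"
      using segU cd q by blast+
    moreover have "e q \<in> K y (e q)" "e c \<in> K y (e q)"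
      using chart_segment_left[OF lcs V(1,2) eq] chart_segment_right[OF lcs V(1,2) eq] cd(1)
      by (auto simp: F_def)
    ultimately have "c \<in> U d"
      using connected_sections_agree[OF hC oU[OF cd(1)] hU[OF cd(1)] oU[OF cd(2)] hU[OF cd(2)]
          chart_segment_connected[OF lcs V(1,2) eq] _ _ q] cU[OF cd(1)] by blast
    moreover have "inj_on e (U d)"
      using homeomorphic_imp_injective_map[OF hU[OF cd(2)]] openin_subset[OF oU[OF cd(2)]]
      by (metis topspace_subtopology_subset)
    moreover have "e c = e d"
      using cd by (simp add: F_def)
    ultimately show ?thesis
      using cU[OF cd(2)] by (meson inj_onD)
  qed
  \<comment> \<open>Otherwise \<open>c\<close> would be an isolated point of the connected space
    \<open>C\<close>, which has further points because the fibre is infinite.\<close>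
  have "\<exists>v. v \<in> e ` U c \<inter> N \<and> v \<noteq> y" if c: "c \<in> F" for c
  proof (rule ccontr)
    assume no: "\<nexists>v. v \<in> e ` U c \<inter> N \<and> v \<noteq> y"
    have cC: "c \<in> topspace C"
      using c by (simp add: F_def)
    have "inj_on e (U c)"
      using homeomorphic_imp_injective_map[OF hU[OF c]] openin_subset[OF oU[OF c]]
      by (metis topspace_subtopology_subset)
    then have "{u \<in> U c. e u \<in> N} = {c}"
      using no cU[OF c] c N(3) unfolding inj_on_def F_def by blast
    then have "openin C {c}"
      using restrict(1)[OF oU[OF c] hU[OF c] oN] by simp
    moreover obtain d where "d \<in> topspace C" "d \<noteq> c"
      using inf unfolding F_def by (metis (no_types, lifting) finite.emptyI finite.insertI
          finite_subset insertI1 mem_Collect_eq subsetI)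
    ultimately show False
      using connected_space_sing_not_open[OF con Hausdorff_imp_t1_space[OF hC] cC] by blast
  qed
  then obtain w where w: "\<And>c. c \<in> F \<Longrightarrow> w c \<in> e ` U c \<inter> N \<and> w c \<noteq> y"
    by metis
  have wV: "w c \<in> V" if "c \<in> F" for c
    using w[OF that] N(2) unfolding convex_in_def by blast
  have \<sigma>: "K y (w c) \<subseteq> e ` U c" "K y (w c) \<subseteq> Z" if c: "c \<in> F" for c
  proof -
    show "K y (w c) \<subseteq> e ` U c"
      using segU[OF c] w[OF c] by blast
    have "K y (w c) \<subseteq> N"
      using w[OF c] N(2,3) unfolding convex_in_def by blast
    then show "K y (w c) \<subseteq> Z"
      using N(4) QZ(4) by blast
  qed
  \<comment> \<open>A closed part of a segment is compact, so its lift through the inverse section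
    is compact and hence closed in the Hausdorff space \<open>C\<close>.\<close>
  have lift: "closedin C {u \<in> U c. e u \<in> A}"
    if c: "c \<in> F" and A: "closedin (subtopology Y V) A" "A \<subseteq> K y (w c)" for c A
  proof -
    have "compactin (subtopology Y V) (K y (w c))"
      using chart_segment_compact[OF lcs V(1,2) wV[OF c]] chart_segment_subset[OF lcs V(1,2) wV[OF c]]
      by (simp add: compactin_subtopology)
    then have "compactin Y A"
      using closed_compactin[OF _ A(2,1)] by (simp add: compactin_subtopology)
    then have cA: "compactin (subtopology Y (e ` U c)) A"
      using A(2) \<sigma>(1)[OF c] by (auto simp: compactin_subtopology)
    obtain s where s: "homeomorphic_maps (subtopology C (U c)) (subtopology Y (e ` U c)) e s"
      using hU[OF c] homeomorphic_map_maps by blast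
    have inv: "s (e u) = u" if "u \<in> U c" for u
      using s that openin_subset[OF oU[OF c]] unfolding homeomorphic_maps_def by auto
    have "compactin (subtopology C (U c)) (s ` A)"
      using image_compactin[OF cA] s unfolding homeomorphic_maps_def by blast
    moreover have "s ` A = {u \<in> U c. e u \<in> A}"
    proof
      show "s ` A \<subseteq> {u \<in> U c. e u \<in> A}"
        using A(2) \<sigma>(1)[OF c] inv by force
      show "{u \<in> U c. e u \<in> A} \<subseteq> s ` A"
        using inv by force
    qed
    ultimately show ?thesis
      using compactin_imp_closedin[OF hC] by (simp add: compactin_subtopology)
  qed
  \<comment> \<open>\<open>Z\<close> is closed relative to \<open>V\<close>, so the lifts are shown
    to be closed relative to the preimage of \<open>V\<close>.\<close>
  define D where "D = {u \<in> topspace C. e u \<in> V}"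
  have "closedin (subtopology Y V) (\<Union>c\<in>F. A c)"
    if A: "\<And>c. c \<in> F \<Longrightarrow> closedin (subtopology Y V) (A c) \<and> A c \<subseteq> K y (w c)" for A
  proof -
    define B where "B = (\<Union>c\<in>F. {u \<in> U c. e u \<in> A c})"
    have UC: "U c \<subseteq> topspace C" if "c \<in> F" for c
      by (rule openin_subset[OF oU[OF that]])
    have BU: "B \<inter> U c = {u \<in> U c. e u \<in> A c}" if "c \<in> F" for c
      using that disj unfolding B_def by blast
    have eB: "e ` B = (\<Union>c\<in>F. A c)"
    proof
      show "e ` B \<subseteq> (\<Union>c\<in>F. A c)"
        unfolding B_def by blast
      show "(\<Union>c\<in>F. A c) \<subseteq> e ` B"
      proof
        fix v assume "v \<in> (\<Union>c\<in>F. A c)"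
        then obtain c where c: "c \<in> F" "v \<in> A c"
          by blast
        then obtain u where "u \<in> U c" "v = e u"
          using A[OF c(1)] \<sigma>(1)[OF c(1)] by blast
        then show "v \<in> e ` B"
          using c unfolding B_def by blast
      qed
    qed
    have BZ: "e u \<in> Z" if "u \<in> B" for u
      using that A \<sigma>(2) unfolding B_def by blast
    have N'V: "N' \<subseteq> V"
      using N'(4) by blast
    \<comment> \<open>Local finiteness of the lifts: points over \<open>V - Z\<close> avoid all of
      them, and every point over \<open>Z\<close> lies in a sheet, which meets only its own lift.
      Both parts of the complement are therefore open.\<close>
    have "D - B = {u \<in> topspace C. e u \<in> V - Z} \<union> (\<Union>c\<in>F. U c - {u \<in> U c. e u \<in> A c})"
    proof (intro equalityI subsetI)
      fix u assume u: "u \<in> D - B"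
      show "u \<in> {u \<in> topspace C. e u \<in> V - Z} \<union> (\<Union>c\<in>F. U c - {u \<in> U c. e u \<in> A c})"
      proof (cases "e u \<in> Z")
        case True
        then obtain c where "c \<in> F" "u \<in> U c"
          using covN'[of u] u QZ(5) unfolding D_def by blast
        then show ?thesis
          using u BU by blast
      next
        case False
        then show ?thesis
          using u unfolding D_def by blast
      qed
    next
      fix u assume "u \<in> {u \<in> topspace C. e u \<in> V - Z} \<union> (\<Union>c\<in>F. U c - {u \<in> U c. e u \<in> A c})"
      then show "u \<in> D - B"
      proof
        assume "u \<in> {u \<in> topspace C. e u \<in> V - Z}"
        then show ?thesis
          using BZ unfolding D_def by blast
      next
        assume "u \<in> (\<Union>c\<in>F. U c - {u \<in> U c. e u \<in> A c})"
        then obtain c where c: "c \<in> F" "u \<in> U c" "u \<notin> {u \<in> U c. e u \<in> A c}"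
          by blast
        then have "u \<notin> B" "e u \<in> N'"
          using BU unfolding U_def by blast+
        then show ?thesis
          using UC[OF c(1)] c(2) N'V unfolding D_def by blast
      qed
    qed
    moreover have "openin Y (V - Z)"
      using QZ(2) oV topV by (metis closedin_def openin_trans_full)
    then have "openin C {u \<in> topspace C. e u \<in> V - Z}"
      by (rule openin_continuous_map_preimage[OF cont])
    moreover have "openin C (U c - {u \<in> U c. e u \<in> A c})" if "c \<in> F" for c
      using openin_diff[OF oU[OF that] lift[OF that]] A[OF that] by blast
    ultimately have "openin C (D - B)"
      by (metis (no_types, lifting) openin_Un openin_Union imageE)
    moreover have "B \<subseteq> D"
      using UC BZ QZ(5) N'V unfolding B_def D_def by blast
    moreover have "D \<subseteq> topspace C"
      unfolding D_def by blast
    ultimately have "closedin (subtopology C D) B"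
      unfolding closedin_def by (metis Diff_subset openin_subset openin_subtopology_Int2
          Int_absorb1 topspace_subtopology_subset)
    moreover have "closed_map (subtopology C D) (subtopology Y V) e"
      by (rule closed_map_restriction[OF clo]) (simp add: D_def)
    ultimately show ?thesis
      using eB unfolding closed_map_def by metis
  qed
  then have "finite F"
    using star_finite_segments[OF cs sf, of y F w] V(2) topV w wV by metis
  then show False
    using inf by simp
qed

theorem proposition10:
  fixes sep :: bool and Y :: "'a topology" and \<V> :: "'a chart set"
    and C :: "'b topology" and e :: "'b \<Rightarrow> 'a"
  assumes "geodesic_q_manifold sep Y \<V>"
    and "etale_map sep C Y \<V> e"
  shows "\<forall>y\<in>topspace Y. finite {c \<in> topspace C. e c = y}"
\<comment> \<open>Without \<open>sep\<close>, (G2) also constrains non-Hausdorff domains and thereby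
  reduces every chart to at most one point.\<close>
proof (cases sep)
  case True
  then have "Hausdorff_space C"
    using assms(2) by (simp add: etale_map_def)
  then show ?thesis
    using etale_fibre_finite_Hausdorff[OF assms] by blast
next
  case False
  then have "geodesic_manifold False Y \<V>"
    using assms(1) by (simp add: geodesic_q_manifold_def)
  then show ?thesis
    using etale_fibre_finite_nonseparated[OF _ assms(2)] by blast
qed

end
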